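(* Let $\beta\in(0,1]$ and consider the SAMBA process with learning-rate function $$\alpha(p)=\frac{\beta}{1-\log p}.$$ Then $(\mathbf p(t))_{t\in\mathbb Z_+}$ is a Markov chain, with probability $1$ we have $p_{a^\star}(t)\to1$ as $t\to\infty$, and for every $T\in\mathbb N$, $$\mathrm{Rg}(T)\le \frac{N}{2\beta\Delta}\big(\log(\beta\Delta T)\big)^2+Q+\Big\lceil \frac{e}{\beta\Delta}\Big\rceil,$$ where $Q:=\sum_{t=0}^\infty\mathbb P\big(p_{a^\star}(t)\le\frac12\big)$.
   Context: Bandit model: $\mathcal A$ is a finite set of arms, $N=|\mathcal A|$. For each arm $a$ and time $t\in\mathbb Z_+=\{0,1,2,\dots\}$, $R_a(t)\in\{0,1\}$ is a Bernoulli random variable with mean $r_a\in[0,1]$; all $R_a(t)$ are independent. There is a unique optimal arm $a^\star$ with $r^\star:=r_{a^\star}>r_a$ for all $a\ne a^\star$, and $\Delta:=r^\star-\max_{a\neq a^\star}r_a>0$. SAMBA process with learning-rate function $\alpha$: $\mathbf p(0)$ is a probability vector on $\mathcal A$ with all entries positive. At each time $t$, let $a_\star(t)$ be an arm maximizing $p_a(t)$ (ties broken uniformly at random) and $p_\star(t)=p_{a_\star(t)}(t)$. Exactly one arm is played at time $t$, arm $a$ with conditional probability $p_a(t)$ given the past (using independent randomization); $I_a(t)$ is the indicator that $a$ is played, $I_\star(t)=I_{a_\star(t)}(t)$, $R_\star(t)=R_{a_\star(t)}(t)$. For each $a\ne a_\star(t)$, $$p_a(t+1)=p_a(t)+\alpha(p_a(t))\,p_a(t)^2\Big[\frac{I_a(t)R_a(t)}{p_a(t)}-\frac{I_\star(t)R_\star(t)}{p_\star(t)}\Big],$$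 and $p_{a_\star(t)}(t+1)=1-\sum_{a\ne a_\star(t)}p_a(t+1)$. Regret: $\mathrm{Rg}(T)=r^\star T-\mathbb E\big[\sum_{t=0}^{T-1}\sum_{a\in\mathcal A}I_a(t)R_a(t)\big]$. *)

theory Defs
  imports "HOL-Probability.Probability"
begin

text \<open>Arms form a finite type with a (fixed, arbitrary) linear order; the order is only
  used to implement the independent randomisation concretely.\<close>

type_synonym 'a noise = "real \<times> real \<times> ('a \<Rightarrow> bool)"
  \<comment> \<open>per-step noise (U, V, R): U uniform on [0,1] selects the played arm,
      V uniform on [0,1] breaks ties, R a = R_a(t) the Bernoulli rewards\<close>

definition maxset :: "('a::finite \<Rightarrow> real) \<Rightarrow> 'a set" where
  "maxset q = {a. \<forall>b. q b \<le> q a}"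

text \<open>uniform tie breaking among maximisers of q, driven by v uniform on [0,1]\<close>
definition tiebreak :: "('a::{finite,linorder} \<Rightarrow> real) \<Rightarrow> real \<Rightarrow> 'a" where
  "tiebreak q v = (let S = sorted_list_of_set (maxset q)
                   in S ! min (length S - 1) (nat \<lfloor>v * real (length S)\<rfloor>))"

text \<open>arm a is played iff u lies in [q(<a), q(\<le>a)), which has probability q a\<close>
definition select_arm :: "('a::{finite,linorder} \<Rightarrow> real) \<Rightarrow> real \<Rightarrow> 'a" where
  "select_arm q u = (if \<exists>a. u < (\<Sum>b\<in>{..a}. q b)
                     then (LEAST a. u < (\<Sum>b\<in>{..a}. q b)) else Max UNIV)"

definition samba_step ::
  "(real \<Rightarrow> real) \<Rightarrow> ('a::{finite,linorder} \<Rightarrow> real) \<Rightarrow> 'a noise \<Rightarrow> ('a \<Rightarrow> real)" where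
  "samba_step \<alpha> q w = (case w of (u, v, R) \<Rightarrow>
     let s = tiebreak q v;
         pl = select_arm q u;
         g = (\<lambda>b. if pl = b \<and> R b then 1 else (0::real));
         new = (\<lambda>b. q b + \<alpha> (q b) * (q b)^2 * (g b / q b - g s / q s))
     in (\<lambda>b. if b = s then 1 - (\<Sum>c\<in>UNIV - {s}. new c) else new b))"

primrec samba_proc ::
  "(real \<Rightarrow> real) \<Rightarrow> ('a::{finite,linorder} \<Rightarrow> real) \<Rightarrow> (nat \<Rightarrow> 'a noise) \<Rightarrow> nat \<Rightarrow> ('a \<Rightarrow> real)" where
  "samba_proc \<alpha> p0 xs 0 = p0"
| "samba_proc \<alpha> p0 xs (Suc t) = samba_step \<alpha> (samba_proc \<alpha> p0 xs t) (xs t)"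

definition played_reward :: "('a::{finite,linorder} \<Rightarrow> real) \<Rightarrow> 'a noise \<Rightarrow> real" where
  "played_reward q w = (case w of (u, v, R) \<Rightarrow> if R (select_arm q u) then 1 else 0)"

definition noise_measure :: "('a::finite \<Rightarrow> real) \<Rightarrow> 'a noise measure" where
  "noise_measure r = uniform_measure lborel {0..1::real} \<Otimes>\<^sub>M
      (uniform_measure lborel {0..1::real} \<Otimes>\<^sub>M
        (\<Pi>\<^sub>M a\<in>UNIV. measure_pmf (bernoulli_pmf (r a))))"

definition alpha_log :: "real \<Rightarrow> real \<Rightarrow> real" where
  "alpha_log \<beta> p = \<beta> / (1 - ln p)"

definition samba_X :: "(real \<Rightarrow> real) \<Rightarrow> ('a::{finite,linorder} \<Rightarrow> real)
     \<Rightarrow> (nat \<Rightarrow> 'w \<Rightarrow> 'a noise) \<Rightarrow> nat \<Rightarrow> 'w \<Rightarrow> ('a \<Rightarrow> real)" where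
  "samba_X \<alpha> p0 \<xi> t \<omega> = samba_proc \<alpha> p0 (\<lambda>s. \<xi> s \<omega>) t"

definition regret :: "'w measure \<Rightarrow> (real \<Rightarrow> real) \<Rightarrow> ('a::{finite,linorder} \<Rightarrow> real)
     \<Rightarrow> (nat \<Rightarrow> 'w \<Rightarrow> 'a noise) \<Rightarrow> real \<Rightarrow> nat \<Rightarrow> real" where
  "regret M \<alpha> p0 \<xi> rstar T = rstar * real T
     - (\<integral>\<omega>. (\<Sum>t<T. played_reward (samba_X \<alpha> p0 \<xi> t \<omega>) (\<xi> t \<omega>)) \<partial>M)"

end

theory Submission
  imports Defs
begin

text \<open>
  Write \<open>p\<close> for the probability of the optimal arm and \<open>N\<close> for the number of arms. The step moves
  only if the played arm yields a reward, and whoever leads, the conditional drift of \<open>p\<close> is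
  nonnegative: it is at least \<open>\<Delta> \<beta> log_rate p\<close> if the optimal arm does not lead, and at least
  \<open>\<Delta> \<beta> \<Sum> log_rate (p\<^sub>a)\<close> over the other arms if it leads, with \<open>log_rate v = v\<^sup>2 / (1 - ln v)\<close>.

  Convergence: as \<open>p \<le> 1\<close>, the drifts are summable in expectation, so by Borel--Cantelli
  \<open>min p (1 - p) \<longlonglongrightarrow> 0\<close> almost surely. Since \<open>p\<close> at most doubles in a step while it is small, it
  tends either to 0 or to 1. As \<open>\<alpha>(p) \<rightarrow> 0\<close> for \<open>p \<rightarrow> 0\<close>, the process \<open>1 / p\<close> is a supermartingale
  while \<open>p\<close> is small, so by Fatou's lemma it cannot tend to infinity, which excludes the limit 0.

  Regret: the regret is bounded by the sum of the expectations of \<open>1 - p\<close>; the times with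
  \<open>p \<le> 1/2\<close> contribute at most \<open>Q\<close>. Let \<open>y\<^sub>k\<close> be the expectation of \<open>1 - p\<close> at the \<open>k\<close>-th time
  with \<open>p > 1/2\<close>. The supermartingale property of \<open>1 - p\<close> and convexity of \<open>log_rate\<close> give
  \<open>y\<^sub>k\<^sub>+\<^sub>1 \<le> y\<^sub>k - \<beta> \<Delta> (N - 1) log_rate (y\<^sub>k / (N - 1))\<close>. The potential \<open>- ln v / v\<close> of
  \<open>v = y\<^sub>k / (N - 1)\<close> thus grows by at least \<open>\<beta> \<Delta>\<close> per step, so \<open>v \<le> ln s / s\<close> with
  \<open>s = \<beta> \<Delta> k\<close> once \<open>s \<ge> e\<close>, and summation over \<open>k\<close> yields the squared logarithm.
\<close>

section \<open>The recursion behind the regret bound\<close>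

text \<open>\<open>\<beta> * log_rate p\<close> is the coefficient \<open>\<alpha> p * p^2\<close>
  of the update, see \<open>alpha_log_square\<close>.\<close>

definition log_rate :: "real \<Rightarrow> real" where
  "log_rate v = v\<^sup>2 / (1 - ln v)"

definition log_rate' :: "real \<Rightarrow> real" where
  "log_rate' v = 2 * v / (1 - ln v) + v / (1 - ln v)\<^sup>2"

section \<open>Sign, monotonicity and convexity of the rate function\<close>

lemma ln_less_one: "0 < x \<Longrightarrow> x < exp 1 \<Longrightarrow> ln x < (1::real)"
  by (metis ln_exp ln_less_cancel_iff exp_gt_zero)

lemma ln_less_one_if_le_one: "0 < x \<Longrightarrow> x \<le> 1 \<Longrightarrow> ln x < (1::real)"
  using ln_le_zero_iff[of x] by linarith

lemma log_rate_pos: "0 < v \<Longrightarrow> v \<le> 1 \<Longrightarrow> 0 < log_rate v"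
  unfolding log_rate_def using ln_less_one_if_le_one[of v] by (intro divide_pos_pos) auto

lemma log_rate_nonneg: "0 \<le> v \<Longrightarrow> v \<le> 1 \<Longrightarrow> 0 \<le> log_rate v"
  using log_rate_pos[of v] by (cases "v = 0") (auto simp: log_rate_def)

lemma log_rate_mono:
  assumes "0 < v" "v \<le> w" "w \<le> 1"
  shows "log_rate v \<le> log_rate w"
proof -
  have "ln v \<le> ln w" "ln w < 1" using assms ln_less_one_if_le_one[of w] by auto
  then show ?thesis unfolding log_rate_def using assms
    by (intro frac_le power_mono) auto
qed

lemma has_real_derivative_log_rate:
  assumes "0 < x" "x < exp 1"
  shows "(log_rate has_real_derivative log_rate' x) (at x)"
proof -
  have L: "1 - ln x > 0" using ln_less_one[OF assms] by simp
  define l where "l = 1 - ln x"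
  have "((\<lambda>v. v\<^sup>2 / (1 - ln v)) has_real_derivative
      ((2 * x) * (1 - ln x) - x\<^sup>2 * (- (1 / x))) / ((1 - ln x) * (1 - ln x))) (at x)"
    using L assms by (auto intro!: derivative_eq_intros)
  also have "((2 * x) * (1 - ln x) - x\<^sup>2 * (- (1 / x))) / ((1 - ln x) * (1 - ln x)) = log_rate' x"
    using L assms unfolding log_rate'_def l_def[symmetric]
    by (simp add: field_simps power2_eq_square)
  finally have "((\<lambda>v. v\<^sup>2 / (1 - ln v)) has_real_derivative log_rate' x) (at x)" .
  then show ?thesis unfolding log_rate_def[abs_def] .
qed

text \<open>The second derivative is a polynomial in \<open>1 / (1 - ln x)\<close> with positive
  coefficients, and \<open>1 - ln x\<close> is positive below \<open>exp 1\<close>. The interval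
  reaches beyond 1 so that 1 is an interior point and admits a tangent.\<close>

lemma convex_on_log_rate: "convex_on {0<..<exp 1} log_rate"
proof (rule f''_ge0_imp_convex)
  fix x :: real assume x: "x \<in> {0<..<exp 1}"
  then have L: "1 - ln x > 0" using ln_less_one[of x] by simp
  show "(log_rate has_real_derivative log_rate' x) (at x)"
    using has_real_derivative_log_rate x by simp
  show "(log_rate' has_real_derivative
      2 / (1 - ln x) + 3 / (1 - ln x)\<^sup>2 + 2 / (1 - ln x)^3) (at x)"
  proof -
    define l where "l = 1 - ln x"
    have "(log_rate' has_real_derivative
        (2 * (1 - ln x) - 2 * x * (- (1 / x))) / ((1 - ln x) * (1 - ln x))
        + ((1 - ln x)\<^sup>2 - x * (2 * (1 - ln x) * (- (1 / x)))) / ((1 - ln x)\<^sup>2 * (1 - ln x)\<^sup>2)) (at x)"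
      unfolding log_rate'_def[abs_def] using L x by (auto intro!: derivative_eq_intros)
    also have "(2 * (1 - ln x) - 2 * x * (- (1 / x))) / ((1 - ln x) * (1 - ln x))
        + ((1 - ln x)\<^sup>2 - x * (2 * (1 - ln x) * (- (1 / x)))) / ((1 - ln x)\<^sup>2 * (1 - ln x)\<^sup>2)
        = 2 / (1 - ln x) + 3 / (1 - ln x)\<^sup>2 + 2 / (1 - ln x)^3"
    proof -
      have "2 * x * (- (1 / x)) = - 2" "x * (2 * (1 - ln x) * (- (1 / x))) = - (2 * l)" "l > 0"
        using x L by (auto simp: l_def)
      moreover have "(2 * l - (- 2)) / (l * l) = 2 / l + 2 / l\<^sup>2"
        using \<open>l > 0\<close> by (simp add: add_divide_distrib power2_eq_square)
      moreover have "(l\<^sup>2 - (- (2 * l))) / (l\<^sup>2 * l\<^sup>2) = 1 / l\<^sup>2 + 2 / l^3"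
        using \<open>l > 0\<close> by (simp add: add_divide_distrib power2_eq_square power3_eq_cube)
      ultimately show ?thesis unfolding l_def[symmetric] by simp
    qed
    finally show ?thesis .
  qed
  show "0 \<le> 2 / (1 - ln x) + 3 / (1 - ln x)\<^sup>2 + 2 / (1 - ln x)^3"
    using L by (intro add_nonneg_nonneg) auto
qed simp

lemma log_rate_above_tangent:
  assumes "0 < p" "p \<le> 1" "0 < s" "s \<le> 1"
  shows "log_rate s + log_rate' s * (p - s) \<le> log_rate p"
proof -
  have "(1::real) < exp 1" by simp
  then have e: "s < exp 1" "p < exp 1" using assms by linarith+
  then have s: "s \<in> interior {0<..<exp 1}" using assms by (simp add: interior_open)
  have "log_rate' s * (p - s) \<le> log_rate p - log_rate s"
    by (rule convex_on_imp_above_tangent[OF convex_on_log_rate _ s])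
      (use assms e in \<open>simp_all add: has_field_derivative_at_within has_real_derivative_log_rate\<close>)
  then show ?thesis by simp
qed

text \<open>Equivalently, the tangent at \<open>s\<close> is at most 0 at the origin. This sign
  makes probability missing from 1 harmless in the averaging of \<open>lead_rate_ge\<close>.\<close>

lemma log_rate_le_mult_deriv:
  assumes "0 < s" "s \<le> 1"
  shows "log_rate s \<le> s * log_rate' s"
proof -
  have L: "ln s < 1" using ln_less_one_if_le_one assms by simp
  have "s * log_rate' s - log_rate s = s\<^sup>2 / (1 - ln s) + s\<^sup>2 / (1 - ln s)\<^sup>2"
    unfolding log_rate_def log_rate'_def by (simp add: algebra_simps power2_eq_square)
  also have "\<dots> \<ge> 0" using L by (intro add_nonneg_nonneg divide_nonneg_nonneg) auto
  finally show ?thesis by simp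
qed

text \<open>The potential \<open>- ln u / u\<close> is the primitive of \<open>- 1 / log_rate\<close>.\<close>

lemma potential_increase:
  assumes "0 < v" "v \<le> 1" "0 < w" "0 \<le> c" and w: "w \<le> v - c * log_rate v"
  shows "- ln v / v + c \<le> - ln w / w"
proof -
  define \<phi> :: "real \<Rightarrow> real" where "\<phi> = (\<lambda>u. - ln u / u)"
  define \<phi>' :: "real \<Rightarrow> real" where "\<phi>' = (\<lambda>u. (ln u - 1) / u\<^sup>2)"
  have "w \<le> v" using w log_rate_pos[of v] assms
    by (smt (verit) mult_nonneg_nonneg)
  have "(1::real) < exp 1" by simp
  then have e: "v < exp 1" "w < exp 1" using assms \<open>w \<le> v\<close> by linarith+
  have d: "(\<phi> has_real_derivative \<phi>' x) (at x)" if "x > 0" for x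
    unfolding \<phi>_def \<phi>'_def using that
    by (auto intro!: derivative_eq_intros simp: field_simps power2_eq_square)
  \<comment> \<open>Convexity lets the tangent at \<open>v\<close> bound the increment of the
    potential from \<open>v\<close> to \<open>w\<close> from below.\<close>
  have "convex_on {0<..<exp 1} \<phi>"
  proof (rule f''_ge0_imp_convex)
    fix x :: real assume x: "x \<in> {0<..<exp 1}"
    then have L: "1 - ln x > 0" using ln_less_one[of x] by simp
    show "(\<phi> has_real_derivative \<phi>' x) (at x)" using d x by simp
    show "(\<phi>' has_real_derivative (3 - 2 * ln x) / x^3) (at x)"
      unfolding \<phi>'_def using x
      by (auto intro!: derivative_eq_intros simp: field_simps power2_eq_square power3_eq_cube)
    show "0 \<le> (3 - 2 * ln x) / x^3" using x L by (intro divide_nonneg_nonneg) auto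
  qed simp
  then have "\<phi>' v * (w - v) \<le> \<phi> w - \<phi> v"
    by (rule convex_on_imp_above_tangent)
      (use assms e in \<open>simp_all add: interior_open has_field_derivative_at_within d\<close>)
  \<comment> \<open>The slope at \<open>v\<close> is \<open>- 1 / log_rate v\<close>, so a decrease
    of the argument by at least \<open>c * log_rate v\<close> raises the tangent by at least
    \<open>c\<close>.\<close>
  moreover have "c \<le> \<phi>' v * (w - v)"
  proof -
    have L: "ln v < 1" using ln_less_one_if_le_one assms by simp
    have "c = (1 - ln v) / v\<^sup>2 * (c * log_rate v)"
      using L assms by (simp add: log_rate_def)
    also have "\<dots> \<le> (1 - ln v) / v\<^sup>2 * (v - w)"
      using L w assms by (intro mult_left_mono) auto
    also have "\<dots> = \<phi>' v * (w - v)" unfolding \<phi>'_def by (simp add: field_simps)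
    finally show ?thesis .
  qed
  ultimately show ?thesis unfolding \<phi>_def by simp
qed

text \<open>If \<open>v > ln s / s\<close>, then \<open>1 / v < s / ln s \<le> s\<close>, because
  \<open>s \<ge> exp 1\<close> gives \<open>ln s \<ge> 1\<close>. Hence
  \<open>- ln v < ln s\<close>, and the potential is below \<open>ln s / v < s\<close>.\<close>

lemma potential_inverse:
  fixes s v :: real
  assumes "exp 1 \<le> s" "0 < v" "v \<le> 1" "s \<le> - ln v / v"
  shows "v \<le> ln s / s"
proof (rule ccontr)
  assume "\<not> ?thesis"
  then have v: "ln s / s < v" by simp
  have s: "0 < s" using assms(1) exp_gt_zero[of "1::real"] by linarith
  then have l: "1 \<le> ln s" using assms(1) ln_ge_iff[of s 1] by simp
  then have l0: "0 < ln s" by linarith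
  have "1 / v < s / ln s" using v s l0 assms by (simp add: field_simps)
  also have "s / ln s \<le> s" using s l l0 by (simp add: field_simps)
  finally have "ln (1 / v) < ln s" using assms(2) s by (subst ln_less_cancel_iff) auto
  then have "- ln v < ln s" using assms(2) by (simp add: ln_div)
  have "- ln v / v < ln s / v" using \<open>- ln v < ln s\<close> assms(2) by (rule divide_strict_right_mono)
  also have "\<dots> \<le> s" using v s assms by (simp add: field_simps)
  finally show False using assms by simp
qed

section \<open>Resolution of the recursion\<close>

text \<open>\<open>(ln (c * x))^2 / (2 * c)\<close> is an antiderivative of
  \<open>ln (c * x) / (c * x)\<close>, which decreases once \<open>c * x \<ge> exp 1\<close>. So
  each term after the first is at most the increment of the antiderivative over the preceding unit
  interval.\<close>

lemma sum_ln_over_self_le: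
  fixes c :: real
  assumes "0 < c" "c \<le> 1" "exp 1 \<le> c * real m" "m \<le> n"
  shows "(\<Sum>k = m..n. ln (c * real k) / (c * real k)) \<le> (ln (c * real n))\<^sup>2 / (2 * c)"
  using \<open>m \<le> n\<close>
proof (induction n rule: dec_induct)
  case base
  let ?s = "c * real m"
  have e: "(2::real) \<le> exp 1" using exp_ge_add_one_self[of 1] by simp
  have s: "2 \<le> ?s" using e assms(3) by linarith
  have "0 < ?s" using s by simp
  then have l: "1 \<le> ln ?s" using assms(3) by (simp add: ln_ge_iff)
  \<comment> \<open>The first term may have no unit interval of the decreasing range to its left. It
    is absorbed instead, through \<open>?s \<ge> 2\<close>, \<open>ln ?s \<ge> 1\<close> and
    \<open>c \<le> 1\<close>.\<close>
  have "ln ?s / ?s \<le> ln ?s / 2" using s l by (intro divide_left_mono) auto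
  also have "\<dots> \<le> (ln ?s)\<^sup>2 / 2" using l by (simp add: power2_eq_square)
  also have "\<dots> \<le> (ln ?s)\<^sup>2 / (2 * c)" using assms by (intro divide_left_mono) auto
  finally show ?case by simp
next
  case (step n)
  define F where "F = (\<lambda>x. (ln (c * x))\<^sup>2 / (2 * c))"
  have n0: "0 < real n"
  proof -
    have "m \<noteq> 0" using assms(3) not_exp_le_zero[of "1::real"] by (metis mult_zero_right of_nat_0)
    then show ?thesis using step(1) by simp
  qed
  have "\<exists>z>real n. z < real (Suc n) \<and>
      F (real (Suc n)) - F (real n) = (real (Suc n) - real n) * (ln (c * z) / (c * z))"
  proof (rule MVT2)
    fix x assume "real n \<le> x" "x \<le> real (Suc n)"
    then have "x > 0" using n0 by simp
    then show "(F has_real_derivative ln (c * x) / (c * x)) (at x)"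
    proof -
      have "((\<lambda>x. (ln (c * x))\<^sup>2 / (2 * c)) has_real_derivative
          2 * ln (c * x) * (1 / (c * x) * c) / (2 * c)) (at x)"
        using assms(1) \<open>x > 0\<close> by (auto intro!: derivative_eq_intros)
      also have "2 * ln (c * x) * (1 / (c * x) * c) / (2 * c) = ln (c * x) / (c * x)"
        using assms(1) \<open>x > 0\<close> by simp
      finally show ?thesis unfolding F_def .
    qed
  qed simp
  then obtain z where z: "z > real n" "z < real (Suc n)"
    "F (real (Suc n)) - F (real n) = ln (c * z) / (c * z)" by auto
  have "exp 1 \<le> c * z"
  proof -
    have "c * real m \<le> c * real n" using step(1) assms by simp
    also have "\<dots> \<le> c * z" using z assms by simp
    finally show ?thesis using assms(3) by linarith
  qed
  then have "ln (c * real (Suc n)) / (c * real (Suc n)) \<le> ln (c * z) / (c * z)"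
    using z assms(1) by (intro ln_x_over_x_mono) (simp_all del: of_nat_Suc)
  moreover have "(\<Sum>k = m..Suc n. ln (c * real k) / (c * real k))
      = (\<Sum>k = m..n. ln (c * real k) / (c * real k)) + ln (c * real (Suc n)) / (c * real (Suc n))"
    using step(1) by (subst sum.nat_ivl_Suc') simp_all
  ultimately show ?case using step(3) z(3) unfolding F_def by linarith
qed

text \<open>Division by \<open>n\<close> turns the recursion into
  \<open>v (Suc k) \<le> v k - c * log_rate (v k)\<close>, so the potential of \<open>v k\<close> is
  at least \<open>c * k\<close>. Inverting it bounds \<open>v k\<close> by
  \<open>ln (c * k) / (c * k)\<close> for large \<open>k\<close>. The hypothesis \<open>zero\<close>
  keeps a vanished sequence at 0, where the potential has no meaning.\<close>

lemma sum_log_rate_recursion_le: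
  fixes y :: "nat \<Rightarrow> real" and c :: real and n T :: nat
  assumes c: "0 < c" "c \<le> 1" and n: "1 \<le> n" and nonneg: "\<And>k. 0 \<le> y k" and y0: "y 0 \<le> 1"
    and rec: "\<And>k. 0 < y k \<Longrightarrow> y (Suc k) \<le> y k - c * real n * log_rate (y k / real n)"
    and zero: "\<And>k. y k = 0 \<Longrightarrow> y (Suc k) = 0"
  shows "(\<Sum>k<T. y k) \<le> real n / (2 * c) * (ln (c * real T))\<^sup>2 + of_int \<lceil>exp 1 / c\<rceil>"
proof -
  define v where "v = (\<lambda>k. y k / real n)"
  have y1: "y k \<le> 1" for k
  proof (induction k)
    case (Suc k)
    show ?case
    proof (cases "y k = 0")
      case False
      then have p: "0 < y k" using nonneg[of k] by simp
      have "0 \<le> log_rate (y k / real n)"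
        using Suc n nonneg[of k] by (intro log_rate_nonneg) (auto simp: field_simps)
      then have "0 \<le> c * real n * log_rate (y k / real n)" using c by simp
      then show ?thesis using rec[OF p] Suc by linarith
    qed (simp add: zero)
  qed (rule y0)
  have v1: "v k \<le> 1" "0 \<le> v k" for k
    using y1[of k] n nonneg[of k] by (auto simp: v_def field_simps)
  have vrec: "v (Suc k) \<le> v k - c * log_rate (v k)" if "0 < v k" for k
  proof -
    have "0 < y k" using that n by (auto simp: v_def zero_less_divide_iff)
    from rec[OF this] show ?thesis using n by (simp add: v_def field_simps)
  qed
  \<comment> \<open>A positive term forces all earlier terms to be positive, so the potential can be
    followed from index 0, where \<open>v 0 \<le> 1\<close> makes it nonnegative.\<close>
  have pot: "c * real k \<le> - ln (v k) / v k" if "0 < v k" for k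
    using that
  proof (induction k)
    case 0
    then show ?case using v1[of 0] by (simp add: divide_nonpos_nonneg)
  next
    case (Suc k)
    have "0 < v k"
    proof (rule ccontr)
      assume "\<not> 0 < v k"
      then have "y k = 0" using v1(2)[of k] n by (auto simp: v_def)
      then show False using zero[of k] Suc.prems by (simp add: v_def)
    qed
    note vk = this
    have "- ln (v k) / v k + c \<le> - ln (v (Suc k)) / v (Suc k)"
      using potential_increase[OF vk v1(1) Suc.prems _ vrec[OF vk]] c by simp
    moreover have "c * real (Suc k) = c * real k + c" by (simp add: algebra_simps)
    ultimately show ?case using Suc.IH[OF vk] by linarith
  qed
  have vb: "v k \<le> ln (c * real k) / (c * real k)" if "exp 1 \<le> c * real k" for k
  proof (cases "v k = 0")
    case True
    have "1 \<le> c * real k" using that one_le_exp_iff[of "1::real"] by linarith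
    then show ?thesis using True by simp
  next
    case False
    then show ?thesis using pot[of k] v1[of k] that by (intro potential_inverse) auto
  qed
  \<comment> \<open>From \<open>m\<close> on \<open>c * k \<ge> exp 1\<close>, as
    \<open>potential_inverse\<close> demands. The \<open>m\<close> earlier terms are at most 1 each
    and produce the ceiling.\<close>
  define m where "m = nat \<lceil>exp 1 / c\<rceil>"
  have "0 \<le> \<lceil>exp 1 / c\<rceil>"
  proof -
    have "0 \<le> exp 1 / c" using c by simp
    then show ?thesis using le_of_int_ceiling[of "exp 1 / c"] by linarith
  qed
  then have m: "real m = of_int \<lceil>exp 1 / c\<rceil>" by (simp add: m_def)
  have "exp 1 / c \<le> real m" unfolding m by simp
  then have em: "exp 1 \<le> c * real m" using c by (simp add: field_simps)
  show ?thesis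
  proof (cases "T \<le> m")
    case True
    have "(\<Sum>k<T. y k) \<le> real T" using sum_mono[of "{..<T}" y "\<lambda>_. 1"] y1 by simp
    moreover have "0 \<le> real n / (2 * c) * (ln (c * real T))\<^sup>2" using c by simp
    ultimately show ?thesis using True m by linarith
  next
    case False
    then obtain T' where T': "T = Suc T'" "m \<le> T'" by (cases T) auto
    have "(\<Sum>k<T. y k) = (\<Sum>k<m. y k) + (\<Sum>k=m..T'. y k)"
      using sum.atLeastLessThan_concat[of 0 m "Suc T'" y] T'
      by (simp add: lessThan_atLeast0 atLeastLessThanSuc_atLeastAtMost)
    also have "(\<Sum>k<m. y k) \<le> real m" using sum_mono[of "{..<m}" y "\<lambda>_. 1"] y1 by simp
    also have "(\<Sum>k=m..T'. y k) \<le> (\<Sum>k=m..T'. real n * (ln (c * real k) / (c * real k)))"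
    proof (rule sum_mono)
      fix k assume "k \<in> {m..T'}"
      then have "c * real m \<le> c * real k" using c by simp
      then have "v k \<le> ln (c * real k) / (c * real k)" using em by (intro vb) simp
      then have "real n * v k \<le> real n * (ln (c * real k) / (c * real k))"
        by (intro mult_left_mono) auto
      then show "y k \<le> real n * (ln (c * real k) / (c * real k))" using n by (simp add: v_def)
    qed
    also have "\<dots> = real n * (\<Sum>k=m..T'. ln (c * real k) / (c * real k))"
      by (simp only: sum_distrib_left)
    also have "\<dots> \<le> real n * ((ln (c * real T'))\<^sup>2 / (2 * c))"
      using sum_ln_over_self_le[OF c em T'(2)] by (intro mult_left_mono) auto
    also have "\<dots> \<le> real n * ((ln (c * real T))\<^sup>2 / (2 * c))"
    proof -
      have "c * real m \<le> c * real T'" using T' c by simp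
      \<comment> \<open>Only where the logarithm is nonnegative is its square increasing.\<close>
      then have 1: "1 \<le> c * real T'" using em one_le_exp_iff[of "1::real"] by linarith
      then have "ln (c * real T') \<le> ln (c * real T)"
        using c T' by (intro ln_mono) auto
      then have "(ln (c * real T'))\<^sup>2 \<le> (ln (c * real T))\<^sup>2" using 1 by (intro power_mono) auto
      then show ?thesis using c by (intro mult_left_mono divide_right_mono) auto
    qed
    finally show ?thesis using m by simp
  qed
qed

section \<open>One step of the algorithm\<close>

text \<open>Strict positivity belongs to the invariant because the update divides by entries and
  takes their logarithms.\<close>

definition prob_vec :: "('a::finite \<Rightarrow> real) \<Rightarrow> bool" where
  "prob_vec q \<longleftrightarrow> (\<forall>a. 0 < q a) \<and> (\<Sum>a\<in>UNIV. q a) = 1"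

text \<open>The successor of \<open>q\<close> when \<open>s\<close> leads and \<open>a\<close> is
  played with a reward. Without a reward \<open>q\<close> stays, so each state has finitely many
  successors.\<close>

definition samba_update :: "(real \<Rightarrow> real) \<Rightarrow> ('a::finite \<Rightarrow> real) \<Rightarrow> 'a \<Rightarrow> 'a \<Rightarrow> 'a \<Rightarrow> real" where
  "samba_update \<alpha> q s a =
     (if a = s then (\<lambda>b. if b = s then q s + (\<Sum>c\<in>UNIV - {s}. \<alpha> (q c) * (q c)\<^sup>2 / q s)
                         else q b - \<alpha> (q b) * (q b)\<^sup>2 / q s)
      else q(a := q a + \<alpha> (q a) * q a, s := q s - \<alpha> (q a) * q a))"

lemma prob_vec_sum_compl: "prob_vec q \<Longrightarrow> (\<Sum>c\<in>UNIV - {s}. q c) = 1 - q s"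
  by (simp add: prob_vec_def sum_diff1)

lemma prob_vec_pos: "prob_vec q \<Longrightarrow> 0 < q a"
  by (simp add: prob_vec_def)

lemma prob_vec_le_1: "prob_vec q \<Longrightarrow> q a \<le> 1"
  using member_le_sum[of a UNIV q] by (simp add: prob_vec_def less_imp_le)

lemma prob_vec_add_le_1:
  assumes "prob_vec q" "a \<noteq> b" shows "q a + q b \<le> 1"
  using sum_mono2[of UNIV "{a, b}" q] assms by (simp add: prob_vec_def less_imp_le)

lemma prob_vec_less_1:
  assumes "prob_vec q" "a \<noteq> b" shows "q a < 1"
  using prob_vec_add_le_1[OF assms] prob_vec_pos[OF assms(1), of b] by linarith

text \<open>The index is clipped to the last position, which covers \<open>v = 1\<close>, so it
  suffices that the list of maximisers is nonempty.\<close>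

lemma tiebreak_in_maxset: "tiebreak q v \<in> maxset q"
proof -
  have "Max (range q) \<in> range q" by (intro Max_in) auto
  then obtain a where a: "q a = Max (range q)" by (metis rangeE)
  have "q b \<le> q a" for b unfolding a by simp
  then have "maxset q \<noteq> {}" unfolding maxset_def by auto
  then have "sorted_list_of_set (maxset q) \<noteq> []" by simp
  then have "sorted_list_of_set (maxset q)
      ! min (length (sorted_list_of_set (maxset q)) - 1) i \<in> set (sorted_list_of_set (maxset q))" for i
    by (intro nth_mem) (metis length_greater_0_conv diff_less less_one min.strict_coboundedI1)
  then show ?thesis unfolding tiebreak_def Let_def by simp
qed

text \<open>The leader receives one minus the other new entries. As the old entries sum to 1, it
  gains exactly what the others lose, or loses what the played arm gains.\<close>

lemma samba_step_eq:
  assumes q: "prob_vec q"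
  shows "samba_step \<alpha> q (u, v, R) =
    (if R (select_arm q u) then samba_update \<alpha> q (tiebreak q v) (select_arm q u) else q)"
proof
  fix b
  define s a where "s = tiebreak q v" and "a = select_arm q u"
  define g :: "'a \<Rightarrow> real" where "g = (\<lambda>b. if a = b \<and> R b then 1 else 0)"
  define new where "new = (\<lambda>b. q b + \<alpha> (q b) * (q b)\<^sup>2 * (g b / q b - g s / q s))"
  have step: "samba_step \<alpha> q (u, v, R) b = (if b = s then 1 - (\<Sum>c\<in>UNIV - {s}. new c) else new b)"
    unfolding samba_step_def new_def g_def s_def a_def by (simp add: Let_def)
  note sum1 = prob_vec_sum_compl[OF q, of s]
  have qpos: "q c \<noteq> 0" for c using prob_vec_pos[OF q, of c] by simp
  consider "\<not> R a" | "R a" "a = s" | "R a" "a \<noteq> s" by blast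
  then have "samba_step \<alpha> q (u, v, R) b = (if R a then samba_update \<alpha> q s a else q) b"
  proof cases
    case 1
    then have "new = q" unfolding new_def g_def by auto
    then show ?thesis using 1 step sum1 by simp
  next
    case 2
    then have new: "c \<noteq> s \<Longrightarrow> new c = q c - \<alpha> (q c) * (q c)\<^sup>2 / q s" for c
      unfolding new_def g_def by auto
    have "(\<Sum>c\<in>UNIV - {s}. new c) = (\<Sum>c\<in>UNIV - {s}. q c - \<alpha> (q c) * (q c)\<^sup>2 / q s)"
      by (intro sum.cong) (auto simp: new)
    also have "\<dots> = 1 - q s - (\<Sum>c\<in>UNIV - {s}. \<alpha> (q c) * (q c)\<^sup>2 / q s)"
      by (simp add: sum_subtractf sum1)
    finally show ?thesis using 2 new step by (simp add: samba_update_def)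
  next
    case 3
    then have new: "new c = (if c = a then q a + \<alpha> (q a) * q a else q c)" for c
      unfolding new_def g_def using qpos[of a] by (auto simp: power2_eq_square)
    have "(\<Sum>c\<in>UNIV - {s}. new c) = (\<Sum>c\<in>UNIV - {s}. q c + (if c = a then \<alpha> (q a) * q a else 0))"
      by (intro sum.cong) (auto simp: new)
    also have "\<dots> = 1 - q s + \<alpha> (q a) * q a"
      using 3 by (simp add: sum.distrib sum1)
    finally show ?thesis using 3 new step by (simp add: samba_update_def)
  qed
  then show "samba_step \<alpha> q (u, v, R) b =
     (if R (select_arm q u) then samba_update \<alpha> q (tiebreak q v) (select_arm q u) else q) b"
    unfolding s_def a_def .
qed

lemma alpha_log_pos: "0 < \<beta> \<Longrightarrow> 0 < p \<Longrightarrow> p \<le> 1 \<Longrightarrow> 0 < alpha_log \<beta> p"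
  unfolding alpha_log_def using ln_less_one_if_le_one[of p] by simp

lemma alpha_log_le_1: "0 < \<beta> \<Longrightarrow> \<beta> \<le> 1 \<Longrightarrow> 0 < p \<Longrightarrow> p \<le> 1 \<Longrightarrow> alpha_log \<beta> p \<le> 1"
proof -
  assume a: "0 < \<beta>" "\<beta> \<le> 1" "0 < p" "p \<le> 1"
  then have "ln p \<le> 0" by simp
  then have "\<beta> \<le> 1 - ln p" "0 < 1 - ln p" using a(2) by linarith+
  then show ?thesis unfolding alpha_log_def by simp
qed

lemma alpha_log_less_1: "0 < \<beta> \<Longrightarrow> \<beta> \<le> 1 \<Longrightarrow> 0 < p \<Longrightarrow> p < 1 \<Longrightarrow> alpha_log \<beta> p < 1"
proof -
  assume a: "0 < \<beta>" "\<beta> \<le> 1" "0 < p" "p < 1"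
  then have "ln p < 0" by simp
  then have "\<beta> < 1 - ln p" "0 < 1 - ln p" using a(2) by linarith+
  then show ?thesis unfolding alpha_log_def by simp
qed

lemma alpha_log_square: "alpha_log \<beta> p * p\<^sup>2 = \<beta> * log_rate p"
  by (simp add: alpha_log_def log_rate_def)

lemma prob_vec_samba_update:
  assumes q: "prob_vec q" and s: "s \<in> maxset q" and \<beta>: "0 < \<beta>" "\<beta> \<le> 1"
  shows "prob_vec (samba_update (alpha_log \<beta>) q s a)"
proof -
  let ?\<alpha> = "alpha_log \<beta>"
  have pos: "0 < q c" "q c \<le> 1" for c using prob_vec_pos[OF q] prob_vec_le_1[OF q] by auto
  have qs: "q c \<le> q s" for c using s by (simp add: maxset_def)
  have \<alpha>: "0 < ?\<alpha> (q c)" for c using alpha_log_pos \<beta> pos by auto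
  \<comment> \<open>One inequality serves both cases: a rewarded arm \<open>c\<close> takes
    \<open>\<alpha> (q c) * q c\<close> from the leader, and a rewarded leader takes from
    \<open>c\<close> the fraction \<open>\<alpha> (q c) * q c / q s\<close> of its entry.\<close>
  have \<alpha>q: "?\<alpha> (q c) * q c < q s" if "c \<noteq> s" for c
  proof -
    have "?\<alpha> (q c) < 1" using alpha_log_less_1[OF \<beta> pos(1) prob_vec_less_1[OF q that]] .
    then have "?\<alpha> (q c) * q c < 1 * q c" using pos by (intro mult_strict_right_mono) auto
    then show ?thesis using qs[of c] by simp
  qed
  show ?thesis
  proof (cases "a = s")
    case True
    have 1: "?\<alpha> (q b) * (q b)\<^sup>2 / q s < q b" if "b \<noteq> s" for b
    proof -
      have "?\<alpha> (q b) * q b * q b < q s * q b"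
        using \<alpha>q[OF that] pos by (intro mult_strict_right_mono) auto
      then show ?thesis using pos[of s] by (simp add: field_simps power2_eq_square)
    qed
    have 2: "0 \<le> (\<Sum>c\<in>UNIV - {s}. ?\<alpha> (q c) * (q c)\<^sup>2 / q s)"
      using pos \<alpha> by (intro sum_nonneg) (simp add: less_imp_le)
    have "(\<Sum>b\<in>UNIV. samba_update ?\<alpha> q s a b)
        = samba_update ?\<alpha> q s a s + (\<Sum>b\<in>UNIV - {s}. samba_update ?\<alpha> q s a b)"
      by (intro sum.remove) auto
    also have "(\<Sum>b\<in>UNIV - {s}. samba_update ?\<alpha> q s a b)
        = (\<Sum>b\<in>UNIV - {s}. q b - ?\<alpha> (q b) * (q b)\<^sup>2 / q s)"
      using True by (intro sum.cong) (auto simp: samba_update_def)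
    also have "\<dots> = 1 - q s - (\<Sum>c\<in>UNIV - {s}. ?\<alpha> (q c) * (q c)\<^sup>2 / q s)"
      by (simp add: sum_subtractf prob_vec_sum_compl[OF q])
    finally have "(\<Sum>b\<in>UNIV. samba_update ?\<alpha> q s a b) = 1"
      using True by (simp add: samba_update_def)
    moreover have "0 < samba_update ?\<alpha> q s a b" for b
      using True 1[of b] 2 pos[of s] by (auto simp: samba_update_def)
    ultimately show ?thesis unfolding prob_vec_def by simp
  next
    case False
    have u: "samba_update ?\<alpha> q s a b
        = q b + (if b = a then ?\<alpha> (q a) * q a else 0) - (if b = s then ?\<alpha> (q a) * q a else 0)" for b
      using False by (simp add: samba_update_def)
    have "0 < samba_update ?\<alpha> q s a b" for b
      using False \<alpha>q[OF False] pos[of b] mult_pos_pos[OF \<alpha>[of a] pos(1)[of a]] by (auto simp: u)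
    moreover have "(\<Sum>b\<in>UNIV. samba_update ?\<alpha> q s a b) = 1"
      using q by (simp add: u sum.distrib sum_subtractf prob_vec_def)
    ultimately show ?thesis unfolding prob_vec_def by simp
  qed
qed

section \<open>Conditional drift of the probability of the optimal arm\<close>

locale bandit =
  fixes r :: "'a::{finite,linorder} \<Rightarrow> real" and astar :: 'a and \<beta> :: real
  assumes reward_bounds: "\<And>a. 0 \<le> r a \<and> r a \<le> 1"
    and two_arms: "CARD('a) \<ge> 2"
    and optimal: "\<And>a. a \<noteq> astar \<Longrightarrow> r a < r astar"
    and rate_pos: "0 < \<beta>" and rate_le_1: "\<beta> \<le> 1"
begin

definition gap :: real where "gap = r astar - Max (r ` (UNIV - {astar}))"

definition others_rate :: "('a \<Rightarrow> real) \<Rightarrow> real" where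
  "others_rate q = (\<Sum>a\<in>UNIV - {astar}. log_rate (q a))"

text \<open>Mean one-step change of \<open>f\<close> given the state \<open>q\<close> and the leader
  \<open>s\<close>: \<open>q a * r a\<close> is the probability that \<open>a\<close> is played and
  rewarded, and unrewarded plays change nothing.\<close>

definition reward_drift :: "(('a \<Rightarrow> real) \<Rightarrow> real) \<Rightarrow> ('a \<Rightarrow> real) \<Rightarrow> 'a \<Rightarrow> real" where
  "reward_drift f q s = (\<Sum>a\<in>UNIV. q a * r a * (f (samba_update (alpha_log \<beta>) q s a) - f q))"

lemma other_arms_nonempty: "UNIV - {astar} \<noteq> ({} :: 'a set)"
proof
  assume "UNIV - {astar} = ({} :: 'a set)"
  then have "(UNIV :: 'a set) = {astar}" by auto
  then have "CARD('a) = 1" by (metis card_1_singleton_iff One_nat_def)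
  then show False using two_arms by simp
qed

lemma gap_le_reward_diff:
  assumes "a \<noteq> astar" shows "gap \<le> r astar - r a"
proof -
  have "r a \<le> Max (r ` (UNIV - {astar}))" using assms by (intro Max_ge) auto
  then show ?thesis by (simp add: gap_def)
qed

lemma gap_pos: "0 < gap"
proof -
  have "Max (r ` (UNIV - {astar})) \<in> r ` (UNIV - {astar})"
    using other_arms_nonempty by (intro Max_in) auto
  then obtain a where "a \<noteq> astar" "Max (r ` (UNIV - {astar})) = r a" by blast
  then show ?thesis using optimal[of a] by (simp add: gap_def)
qed

lemma gap_le_1: "gap \<le> 1"
proof -
  obtain a where "a \<noteq> astar" using other_arms_nonempty by auto
  then show ?thesis using gap_le_reward_diff[of a] reward_bounds[of a] reward_bounds[of astar] by linarith
qed

lemma reward_drift_not_leader: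
  assumes "s \<noteq> astar"
  shows "reward_drift f q s =
    q astar * r astar * (f (samba_update (alpha_log \<beta>) q s astar) - f q)
    + q s * r s * (f (samba_update (alpha_log \<beta>) q s s) - f q)
    + (\<Sum>a\<in>UNIV - {astar, s}. q a * r a * (f (samba_update (alpha_log \<beta>) q s a) - f q))"
proof -
  have "UNIV = {astar, s} \<union> (UNIV - {astar, s})" by auto
  then have "reward_drift f q s = (\<Sum>a\<in>{astar, s} \<union> (UNIV - {astar, s}).
      q a * r a * (f (samba_update (alpha_log \<beta>) q s a) - f q))"
    unfolding reward_drift_def by metis
  also have "\<dots> = (\<Sum>a\<in>{astar, s}. q a * r a * (f (samba_update (alpha_log \<beta>) q s a) - f q))
     + (\<Sum>a\<in>UNIV - {astar, s}. q a * r a * (f (samba_update (alpha_log \<beta>) q s a) - f q))"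
    by (intro sum.union_disjoint) auto
  finally show ?thesis using assms by simp
qed

text \<open>Only rewarded plays of \<open>astar\<close> and of the leader move
  \<open>q astar\<close>. Weighted by their probabilities, the gain and the loss are
  \<open>\<alpha> p * p^2\<close> times \<open>r astar\<close> and \<open>r s\<close> for
  \<open>p = q astar\<close>, so the gap appears as a factor.\<close>

lemma best_drift_not_leader:
  assumes q: "prob_vec q" and s: "s \<noteq> astar"
  shows "gap * \<beta> * log_rate (q astar) \<le> reward_drift (\<lambda>q. q astar) q s"
proof -
  let ?\<alpha> = "alpha_log \<beta>"
  have pos: "0 < q c" for c using prob_vec_pos[OF q] .
  have "(\<Sum>a\<in>UNIV - {astar, s}. q a * r a * (samba_update ?\<alpha> q s a astar - q astar)) = 0"
    using s by (intro sum.neutral) (auto simp: samba_update_def)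
  then have "reward_drift (\<lambda>q. q astar) q s
      = q astar * r astar * (?\<alpha> (q astar) * q astar)
        - q s * r s * (?\<alpha> (q astar) * (q astar)\<^sup>2 / q s)"
    using s by (simp add: reward_drift_not_leader samba_update_def)
  also have "\<dots> = (r astar - r s) * (?\<alpha> (q astar) * (q astar)\<^sup>2)"
    using pos[of s] by (simp add: algebra_simps power2_eq_square)
  also have "\<dots> = (r astar - r s) * (\<beta> * log_rate (q astar))" by (simp only: alpha_log_square)
  also have "\<dots> \<ge> gap * (\<beta> * log_rate (q astar))"
    using gap_le_reward_diff[OF s] rate_pos log_rate_nonneg[of "q astar"] pos[of astar] prob_vec_le_1[OF q, of astar]
    by (intro mult_right_mono mult_nonneg_nonneg) auto
  finally show ?thesis by simp
qed

text \<open>Against each other arm \<open>a\<close>, the leader gains \<open>r astar\<close> and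
  loses \<open>r a\<close> times the same amount \<open>\<beta> * log_rate (q a)\<close> on
  average.\<close>

lemma best_drift_leader:
  assumes q: "prob_vec q"
  shows "gap * \<beta> * others_rate q \<le> reward_drift (\<lambda>q. q astar) q astar"
proof -
  let ?\<alpha> = "alpha_log \<beta>"
  have pos: "0 < q c" for c using prob_vec_pos[OF q] .
  have "reward_drift (\<lambda>q. q astar) q astar
     = q astar * r astar * (samba_update ?\<alpha> q astar astar astar - q astar)
     + (\<Sum>a\<in>UNIV - {astar}. q a * r a * (samba_update ?\<alpha> q astar a astar - q astar))"
    unfolding reward_drift_def by (intro sum.remove) auto
  also have "(\<Sum>a\<in>UNIV - {astar}. q a * r a * (samba_update ?\<alpha> q astar a astar - q astar))
     = (\<Sum>a\<in>UNIV - {astar}. - (r a * (\<beta> * log_rate (q a))))"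
    unfolding alpha_log_square[symmetric]
    by (intro sum.cong) (auto simp: samba_update_def power2_eq_square)
  also have "q astar * r astar * (samba_update ?\<alpha> q astar astar astar - q astar)
     = (\<Sum>a\<in>UNIV - {astar}. r astar * (\<beta> * log_rate (q a)))"
    unfolding alpha_log_square[symmetric] using pos[of astar]
    by (simp add: samba_update_def sum_distrib_left)
  also have "(\<Sum>a\<in>UNIV - {astar}. r astar * (\<beta> * log_rate (q a)))
      + (\<Sum>a\<in>UNIV - {astar}. - (r a * (\<beta> * log_rate (q a))))
      = (\<Sum>a\<in>UNIV - {astar}. (r astar - r a) * (\<beta> * log_rate (q a)))"
    by (simp add: sum.distrib[symmetric] algebra_simps)
  also have "\<dots> \<ge> (\<Sum>a\<in>UNIV - {astar}. gap * (\<beta> * log_rate (q a)))"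
    using gap_le_reward_diff rate_pos log_rate_nonneg pos prob_vec_le_1[OF q]
    by (intro sum_mono mult_right_mono mult_nonneg_nonneg) (auto simp: less_imp_le)
  finally show ?thesis by (simp add: others_rate_def sum_distrib_left mult.assoc)
qed

text \<open>A bound that does not depend on the leader and stays away from 0 unless
  \<open>q astar\<close> is close to 0 or 1; this is the form needed for Borel--Cantelli.\<close>

lemma best_drift_ge:
  assumes q: "prob_vec q"
  shows "gap * \<beta> * log_rate (min (q astar) (1 - q astar) / real CARD('a))
    \<le> reward_drift (\<lambda>q. q astar) q s"
proof -
  let ?m = "min (q astar) (1 - q astar) / real CARD('a)"
  have pos: "0 < q c" "q c \<le> 1" for c using prob_vec_pos[OF q] prob_vec_le_1[OF q] by auto
  obtain b where b: "b \<noteq> astar" using other_arms_nonempty by auto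
  have N: "1 \<le> real CARD('a)" using two_arms by simp
  have lt: "q astar < 1" using prob_vec_less_1[OF q] b by metis
  have m: "0 < ?m" using pos lt N by simp
  have m1: "?m \<le> q astar / 1" using pos[of astar] N by (intro frac_le) auto
  have gb: "0 \<le> gap * \<beta>" using gap_pos rate_pos by simp
  show ?thesis
  proof (cases "s = astar")
    case False
    have "log_rate ?m \<le> log_rate (q astar)" using m m1 pos by (intro log_rate_mono) auto
    then show ?thesis
      using best_drift_not_leader[OF q False] mult_left_mono[OF _ gb] by fastforce
  next
    case True
    \<comment> \<open>Pigeonhole: the other arms share the mass \<open>1 - q astar\<close>, and
      there are fewer than \<open>CARD('a)\<close> of them.\<close>
    have "\<exists>a\<in>UNIV - {astar}. (1 - q astar) / real CARD('a) \<le> q a"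
    proof (rule ccontr)
      assume "\<not> ?thesis"
      then have "(\<Sum>a\<in>UNIV - {astar}. q a) < (\<Sum>a\<in>UNIV - {astar}. (1 - q astar) / real CARD('a))"
        using other_arms_nonempty by (intro sum_strict_mono) (auto simp: not_le)
      also have "\<dots> = real (CARD('a) - 1) * ((1 - q astar) / real CARD('a))" by simp
      also have "\<dots> \<le> real CARD('a) * ((1 - q astar) / real CARD('a))"
        using lt by (intro mult_right_mono) auto
      finally show False using prob_vec_sum_compl[OF q, of astar] N by simp
    qed
    then obtain a where a: "a \<noteq> astar" "(1 - q astar) / real CARD('a) \<le> q a" by auto
    have "?m \<le> (1 - q astar) / real CARD('a)" using N by (intro divide_right_mono) auto
    then have "log_rate ?m \<le> log_rate (q a)" using m a pos[of a] by (intro log_rate_mono) auto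
    also have "\<dots> \<le> others_rate q"
      unfolding others_rate_def using a pos log_rate_nonneg
      by (intro member_le_sum) (auto simp: less_imp_le)
    finally show ?thesis
      using best_drift_leader[OF q] mult_left_mono[OF _ gb] True by fastforce
  qed
qed

text \<open>With \<open>x = p / q s\<close> the two contributions are
  \<open>- r astar * \<alpha> / (1 + \<alpha>)\<close> and
  \<open>r s * \<alpha> / (1 - \<alpha> * x)\<close>. Their sum is at most 0 as soon as
  \<open>r s * (1 + \<alpha>) \<le> r astar * (1 - \<alpha> * x)\<close>, which follows from
  \<open>2 * \<alpha> \<le> gap\<close> and rewards bounded by 1.\<close>

lemma inverse_best_drift_le:
  assumes q: "prob_vec q" and s: "s \<noteq> astar" and max: "s \<in> maxset q"
    and small: "alpha_log \<beta> (q astar) \<le> gap / 2"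
  shows "reward_drift (\<lambda>q. 1 / q astar) q s \<le> 0"
proof -
  define p \<alpha> where "p = q astar" and "\<alpha> = alpha_log \<beta> (q astar)"
  have pos: "0 < q c" "q c \<le> 1" for c using prob_vec_pos[OF q] prob_vec_le_1[OF q] by auto
  have p: "0 < p" "p \<le> 1" "p \<le> q s" "0 < q s" using pos max by (auto simp: p_def maxset_def)
  have a0: "0 < \<alpha>" using alpha_log_pos rate_pos p unfolding \<alpha>_def p_def by auto
  have "p < 1" unfolding p_def using prob_vec_less_1[OF q s[symmetric]] .
  then have a1: "\<alpha> < 1" using alpha_log_less_1 rate_pos rate_le_1 p unfolding \<alpha>_def p_def by auto
  define x where "x = p / q s"
  have x: "0 < x" "x \<le> 1" "p = x * q s" using p by (auto simp: x_def)
  have "\<alpha> * x \<le> \<alpha>" using x a0 by (intro mult_left_le) auto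
  then have ax: "\<alpha> * x < 1" using a1 by linarith
  have "(\<Sum>a\<in>UNIV - {astar, s}. q a * r a
      * (1 / samba_update (alpha_log \<beta>) q s a astar - 1 / q astar)) = 0"
    using s by (intro sum.neutral) (auto simp: samba_update_def)
  then have "reward_drift (\<lambda>q. 1 / q astar) q s
      = p * r astar * (1 / (p + \<alpha> * p) - 1 / p) + q s * r s * (1 / (p - \<alpha> * p\<^sup>2 / q s) - 1 / p)"
    using s by (simp add: reward_drift_not_leader samba_update_def p_def \<alpha>_def)
  also have "p * r astar * (1 / (p + \<alpha> * p) - 1 / p) = - (r astar * \<alpha> / (1 + \<alpha>))"
  proof -
    have "1 / (p + \<alpha> * p) - 1 / p = - \<alpha> / ((1 + \<alpha>) * p)"
    proof -
      have "p + \<alpha> * p = (1 + \<alpha>) * p" by (simp add: algebra_simps)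
      then show ?thesis using p a0 by (simp add: divide_simps)
    qed
    then show ?thesis using p by simp
  qed
  also have "q s * r s * (1 / (p - \<alpha> * p\<^sup>2 / q s) - 1 / p) = r s * \<alpha> / (1 - \<alpha> * x)"
  proof -
    have "p - \<alpha> * p\<^sup>2 / q s = p * (1 - \<alpha> * x)"
      by (simp add: x_def power2_eq_square algebra_simps)
    then have "1 / (p - \<alpha> * p\<^sup>2 / q s) - 1 / p = \<alpha> * x / (p * (1 - \<alpha> * x))"
      using p ax by (simp add: divide_simps)
    also have "\<dots> = \<alpha> / (q s * (1 - \<alpha> * x))" using x p by simp
    finally show ?thesis using p by simp
  qed
  also have "- (r astar * \<alpha> / (1 + \<alpha>)) + r s * \<alpha> / (1 - \<alpha> * x) \<le> 0"
  proof -
    have "r s * (1 + \<alpha>) \<le> r astar * (1 - \<alpha> * x)"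
    proof -
      have "r s * \<alpha> \<le> 1 * \<alpha>" using reward_bounds[of s] a0 by (intro mult_right_mono) auto
      moreover have "r astar * (\<alpha> * x) \<le> 1 * (\<alpha> * 1)"
        using reward_bounds[of astar] a0 x by (intro mult_mono) auto
      moreover have "2 * \<alpha> \<le> gap" using small by (simp add: \<alpha>_def)
      ultimately show ?thesis using gap_le_reward_diff[OF s] by (simp add: algebra_simps)
    qed
    then have "r s / (1 - \<alpha> * x) \<le> r astar / (1 + \<alpha>)" using ax a0 by (simp add: field_simps)
    then have "\<alpha> * (r s / (1 - \<alpha> * x)) \<le> \<alpha> * (r astar / (1 + \<alpha>))"
      using a0 by (intro mult_left_mono) auto
    then show ?thesis by (simp add: mult.commute)
  qed
  finally show ?thesis .
qed

text \<open>The largest gain is \<open>\<alpha> p * p \<le> p\<close>. This prevents a jump from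
  near 0 to near 1 in one step.\<close>

lemma samba_update_le_double:
  assumes q: "prob_vec q" and s: "s \<noteq> astar"
  shows "samba_update (alpha_log \<beta>) q s a astar \<le> 2 * q astar"
proof -
  have pos: "0 < q c" "q c \<le> 1" for c using prob_vec_pos[OF q] prob_vec_le_1[OF q] by auto
  have "alpha_log \<beta> (q astar) * q astar \<le> 1 * q astar" "0 \<le> alpha_log \<beta> (q astar)"
    using alpha_log_le_1[OF rate_pos rate_le_1 pos] alpha_log_pos[OF rate_pos pos, of astar] pos[of astar]
    by (auto intro!: mult_right_mono simp: less_imp_le)
  moreover from this have "0 \<le> alpha_log \<beta> (q astar) * (q astar)\<^sup>2 / q s"
    using pos[of s] by simp
  ultimately show ?thesis using s pos[of astar] by (auto simp: samba_update_def)
qed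

end

section \<open>Integrals over the noise\<close>

abbreviation unit_uniform :: "real measure" where
  "unit_uniform \<equiv> uniform_measure lborel {0..1}"

abbreviation reward_measure :: "('a::finite \<Rightarrow> real) \<Rightarrow> ('a \<Rightarrow> bool) measure" where
  "reward_measure r \<equiv> \<Pi>\<^sub>M a\<in>UNIV. measure_pmf (bernoulli_pmf (r a))"

lemma prob_space_unit_uniform: "prob_space unit_uniform"
  by (intro prob_space_uniform_measure) auto

lemma prob_space_reward_measure: "prob_space (reward_measure r)"
  by (intro prob_space_PiM prob_space_measure_pmf)

lemma prob_space_noise_measure: "prob_space (noise_measure r)"
  unfolding noise_measure_def
  by (intro prob_space_pair prob_space_unit_uniform prob_space_reward_measure)

lemma space_noise_measure: "space (noise_measure r) = UNIV"
  by (simp add: noise_measure_def space_pair_measure space_PiM)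

text \<open>There are finitely many reward vectors and each singleton is a measurable box, so the
  sigma-algebra is discrete.\<close>

lemma sets_reward_measure: "A \<in> sets (reward_measure r)"
proof -
  have "{R} \<in> sets (reward_measure r)" for R :: "'a \<Rightarrow> bool"
  proof -
    have "{R} = (\<Pi>\<^sub>E a\<in>UNIV. {R a})" by (auto simp: PiE_def fun_eq_iff)
    then show ?thesis by (auto intro!: sets_PiM_I_finite)
  qed
  then have "(\<Union>R\<in>A. {R}) \<in> sets (reward_measure r)" by (intro sets.finite_UN) auto
  then show ?thesis by simp
qed

section \<open>Measurability of the random choices\<close>

lemma measurable_tiebreak: "tiebreak q \<in> borel \<rightarrow>\<^sub>M count_space UNIV"
proof -
  have "(\<lambda>v. sorted_list_of_set (maxset q) ! min (length (sorted_list_of_set (maxset q)) - 1)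
      (nat \<lfloor>v * real (length (sorted_list_of_set (maxset q)))\<rfloor>)) \<in> borel \<rightarrow>\<^sub>M count_space UNIV"
    by measurable
  then show ?thesis unfolding tiebreak_def[abs_def] Let_def .
qed

text \<open>The played arm depends on \<open>u\<close> only through the set of arms whose cumulative
  sum exceeds \<open>u\<close>. This set takes finitely many values, each on a Borel set given by
  finitely many comparisons.\<close>

lemma measurable_select_arm: "select_arm q \<in> borel \<rightarrow>\<^sub>M count_space UNIV"
proof -
  define c where "c = (\<lambda>a. \<Sum>b\<in>{..a}. q b)"
  have "(\<lambda>u. {a. u < c a}) \<in> borel \<rightarrow>\<^sub>M count_space UNIV"
  proof (subst measurable_count_space_eq2)
    show "finite (UNIV :: 'a set set)" by simp
    have "(\<lambda>u. {a. u < c a}) -` {S} \<inter> space borel \<in> sets borel" for S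
    proof -
      have "(\<lambda>u. {a. u < c a}) -` {S} \<inter> space borel = {u\<in>space borel. \<forall>a. (u < c a) = (a \<in> S)}"
        by auto
      also have "\<dots> \<in> sets borel" by measurable
      finally show ?thesis .
    qed
    then show "(\<lambda>u. {a. u < c a}) \<in> space borel \<rightarrow> UNIV \<and>
      (\<forall>S\<in>UNIV. (\<lambda>u. {a. u < c a}) -` {S} \<inter> space borel \<in> sets borel)" by auto
  qed
  then have "(\<lambda>u. (\<lambda>S. if S \<noteq> {} then (LEAST a. a \<in> S) else Max UNIV) {a. u < c a})
      \<in> borel \<rightarrow>\<^sub>M count_space UNIV"
    by (rule measurable_compose) simp
  moreover have "select_arm q = (\<lambda>u. (\<lambda>S. if S \<noteq> {} then (LEAST a. a \<in> S) else Max UNIV) {a. u < c a})"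
    by (auto simp: select_arm_def c_def fun_eq_iff)
  ultimately show ?thesis by simp
qed

text \<open>Played arm, leader and reward vector take finitely many values on measurable sets, so
  \<open>G\<close> may be arbitrary.\<close>

lemma measurable_noise_function:
  fixes q :: "'a::{finite,linorder} \<Rightarrow> real"
  shows "(\<lambda>w. G (select_arm q (fst w)) (tiebreak q (fst (snd w))) (snd (snd w)))
    \<in> noise_measure r \<rightarrow>\<^sub>M count_space UNIV"
proof -
  have sets: "sets unit_uniform = sets borel" by simp
  have 1: "(\<lambda>w. select_arm q (fst w)) \<in> noise_measure r \<rightarrow>\<^sub>M count_space UNIV"
    unfolding noise_measure_def
    by (rule measurable_compose[OF measurable_fst], subst measurable_cong_sets[OF sets refl])
      (simp_all add: measurable_select_arm)
  have 2: "(\<lambda>w. tiebreak q (fst (snd w))) \<in> noise_measure r \<rightarrow>\<^sub>M count_space UNIV"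
    unfolding noise_measure_def
    by (rule measurable_compose[OF measurable_snd], rule measurable_compose[OF measurable_fst],
        subst measurable_cong_sets[OF sets refl]) (simp_all add: measurable_tiebreak)
  have "(\<lambda>R. R) \<in> reward_measure r \<rightarrow>\<^sub>M count_space UNIV"
    by (auto simp: measurable_def sets_reward_measure)
  then have 3: "(\<lambda>w. snd (snd w)) \<in> noise_measure r \<rightarrow>\<^sub>M count_space UNIV"
    unfolding noise_measure_def
    by (intro measurable_compose[OF measurable_snd] measurable_compose[OF measurable_snd])
  show ?thesis
    by (rule measurable_compose_countable'[OF _ 1 countable_finite[OF finite]],
        rule measurable_compose_countable'[OF _ 2 countable_finite[OF finite]],
        rule measurable_compose[OF 3]) simp
qed

section \<open>Joint law of the played arm, the leader and the reward\<close>

text \<open>Within \<open>{0..1}\<close> the preimage of \<open>a\<close> lies between the intervals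
  \<open>{L..<H}\<close> and \<open>{L..H}\<close>, both of length \<open>q a\<close>; the sandwich
  avoids deciding the endpoints.\<close>

lemma emeasure_select_arm:
  assumes q: "prob_vec q"
  shows "emeasure unit_uniform {u. select_arm q u = a} = ennreal (q a)"
proof -
  define S where "S = {0..1} \<inter> {u. select_arm q u = a}"
  define L H where "L = (\<Sum>b\<in>{..<a}. q b)" and "H = (\<Sum>b\<in>{..a}. q b)"
  have qn: "0 \<le> q b" for b using prob_vec_pos[OF q, of b] by simp
  have "{..a} = insert a {..<a}" by auto
  then have HL: "H = L + q a" by (simp add: H_def L_def)
  have L0: "0 \<le> L" unfolding L_def by (intro sum_nonneg qn)
  have H1: "H \<le> 1" unfolding H_def using q sum_mono2[of UNIV "{..a}" q] qn by (simp add: prob_vec_def)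
  have meas: "{u. select_arm q u = a} \<in> sets borel"
    using measurable_sets[OF measurable_select_arm, of "{a}" q] by (simp add: vimage_def)
  have sub1: "{L..<H} \<subseteq> S"
  proof
    fix u assume u: "u \<in> {L..<H}"
    have "(LEAST a. u < (\<Sum>b\<in>{..a}. q b)) = a"
    proof (rule Least_equality)
      show "u < (\<Sum>b\<in>{..a}. q b)" using u by (simp add: H_def)
      fix y assume y: "u < (\<Sum>b\<in>{..y}. q b)"
      show "a \<le> y"
      proof (rule ccontr)
        assume "\<not> a \<le> y"
        then have "(\<Sum>b\<in>{..y}. q b) \<le> L" unfolding L_def by (intro sum_mono2) (auto intro: qn)
        then show False using y u by simp
      qed
    qed
    moreover have "\<exists>a. u < (\<Sum>b\<in>{..a}. q b)" using u by (auto simp: H_def)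
    ultimately show "u \<in> S" using u L0 H1 by (auto simp: S_def select_arm_def)
  qed
  have sub2: "S \<subseteq> {L..H}"
  proof
    fix u assume "u \<in> S"
    then have u: "0 \<le> u" "u \<le> 1" "select_arm q u = a" by (auto simp: S_def)
    show "u \<in> {L..H}"
    proof (cases "\<exists>a. u < (\<Sum>b\<in>{..a}. q b)")
      case True
      then have a: "a = Min {a. u < (\<Sum>b\<in>{..a}. q b)}"
        using u(3) Least_Min[of "\<lambda>a. u < (\<Sum>b\<in>{..a}. q b)"] by (simp add: select_arm_def)
      have "a \<in> {a. u < (\<Sum>b\<in>{..a}. q b)}" unfolding a using True by (intro Min_in) auto
      moreover have "L \<le> u"
      proof (cases "{..<a} = {}")
        case False
        \<comment> \<open>The predecessor of \<open>a\<close> in the finite order. By minimality of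
          \<open>a\<close>, its cumulative sum, which equals \<open>L\<close>, does not exceed
          \<open>u\<close>.\<close>
        define a' where "a' = Max {..<a}"
        have a': "a' < a" using Max_in[OF _ False] by (auto simp: a'_def)
        have "{..<a} = {..a'}" using a' by (auto simp: a'_def intro: Max_ge)
        moreover have "\<not> u < (\<Sum>b\<in>{..a'}. q b)"
          using a' Min_le[of "{a. u < (\<Sum>b\<in>{..a}. q b)}" a'] by (auto simp: a[symmetric])
        ultimately show ?thesis unfolding L_def by simp
      qed (use u in \<open>simp add: L_def\<close>)
      ultimately show ?thesis by (simp add: H_def)
    next
      case False
      \<comment> \<open>The default value is reached inside \<open>{0..1}\<close> only at
        \<open>u = 1\<close>, the right endpoint of the interval of the last arm.\<close>
      then have "a = Max UNIV" using u(3) by (simp add: select_arm_def)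
      then have "{..a} = UNIV" by auto
      then have "H = 1" using q by (simp add: H_def prob_vec_def)
      moreover have "H \<le> u" using False unfolding H_def by (simp add: not_less)
      ultimately show ?thesis using u(2) HL qn[of a] by simp
    qed
  qed
  have Sm: "S \<in> sets lborel" unfolding S_def using meas by simp
  have "emeasure lborel S = ennreal (q a)"
  proof (rule antisym)
    have "emeasure lborel S \<le> emeasure lborel {L..H}" by (intro emeasure_mono sub2) auto
    then show "emeasure lborel S \<le> ennreal (q a)" using HL qn[of a] by simp
    have "emeasure lborel {L..<H} \<le> emeasure lborel S" by (intro emeasure_mono sub1 Sm)
    then show "ennreal (q a) \<le> emeasure lborel S" using HL qn[of a] by simp
  qed
  then show ?thesis using meas by (simp add: emeasure_uniform_measure S_def divide_ennreal_def)
qed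

lemma emeasure_reward:
  assumes "0 \<le> r a" "r a \<le> 1"
  shows "emeasure (reward_measure r) {R. R a} = ennreal (r a)"
proof -
  interpret product_prob_space "\<lambda>a. measure_pmf (bernoulli_pmf (r a))" UNIV
    by unfold_locales
  have "emeasure (reward_measure r) {R\<in>space (reward_measure r). R a \<in> {True}}
      = emeasure (measure_pmf (bernoulli_pmf (r a))) {True}"
    by (rule emeasure_PiM_Collect_single) auto
  then show ?thesis using assms by (simp add: space_PiM emeasure_pmf_single)
qed

text \<open>The conditional law of the leader given \<open>q\<close>. It is a probability vector
  carried by \<open>maxset q\<close>, so drift bounds valid for every possible leader pass to the
  average.\<close>

definition tie_prob :: "('a::{finite,linorder} \<Rightarrow> real) \<Rightarrow> 'a \<Rightarrow> real" where
  "tie_prob q s = measure unit_uniform {v. tiebreak q v = s}"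

lemma tiebreak_vimage_sets: "{v. tiebreak q v = s} \<in> sets borel"
  using measurable_sets[OF measurable_tiebreak, of "{s}" q] by (simp add: vimage_def)

lemma tie_prob_nonneg: "0 \<le> tie_prob q s"
  by (simp add: tie_prob_def)

lemma tie_prob_outside: "s \<notin> maxset q \<Longrightarrow> tie_prob q s = 0"
proof -
  assume "s \<notin> maxset q"
  then have "{v. tiebreak q v = s} = {}" using tiebreak_in_maxset[of q] by auto
  then show ?thesis unfolding tie_prob_def by simp
qed

lemma sum_tie_prob: "(\<Sum>s\<in>UNIV. tie_prob q s) = 1"
proof -
  interpret prob_space unit_uniform by (rule prob_space_unit_uniform)
  have "prob (\<Union>s\<in>UNIV. {v. tiebreak q v = s}) = (\<Sum>s\<in>UNIV. prob {v. tiebreak q v = s})"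
    by (intro finite_measure_finite_Union)
      (auto simp: disjoint_family_on_def tiebreak_vimage_sets)
  moreover have "(\<Union>s\<in>UNIV. {v. tiebreak q v = s}) = space unit_uniform" by auto
  ultimately show ?thesis unfolding tie_prob_def using prob_space by simp
qed

text \<open>For fixed \<open>a\<close> and \<open>s\<close> the event is a product set in the three
  independent components of the noise; its measure factorises.\<close>

lemma measure_noise_rectangle:
  assumes q: "prob_vec q" and r: "\<And>a. 0 \<le> r a \<and> r a \<le> 1"
  shows "{w. select_arm q (fst w) = a \<and> tiebreak q (fst (snd w)) = s \<and> snd (snd w) a}
      \<in> sets (noise_measure r)" (is "?S \<in> _")
    and "measure (noise_measure r)
      {w. select_arm q (fst w) = a \<and> tiebreak q (fst (snd w)) = s \<and> snd (snd w) a}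
      = q a * (tie_prob q s * r a)"
proof -
  interpret U: prob_space unit_uniform by (rule prob_space_unit_uniform)
  interpret R: prob_space "reward_measure r" by (rule prob_space_reward_measure)
  interpret UR: prob_space "unit_uniform \<Otimes>\<^sub>M reward_measure r"
    by (intro prob_space_pair U.prob_space_axioms R.prob_space_axioms)
  have S: "?S = {u. select_arm q u = a} \<times> ({v. tiebreak q v = s} \<times> {R. R a})" by auto
  have m: "{u. select_arm q u = a} \<in> sets unit_uniform" "{v. tiebreak q v = s} \<in> sets unit_uniform"
    using measurable_sets[OF measurable_select_arm, of "{a}" q] tiebreak_vimage_sets
    by (simp_all add: vimage_def)
  show "?S \<in> sets (noise_measure r)"
    unfolding S noise_measure_def by (intro pair_measureI m sets_reward_measure)
  have "emeasure (noise_measure r) ?S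
      = ennreal (q a) * (ennreal (tie_prob q s) * ennreal (r a))"
  proof -
    have "emeasure (unit_uniform \<Otimes>\<^sub>M reward_measure r) ({v. tiebreak q v = s} \<times> {R. R a})
        = emeasure unit_uniform {v. tiebreak q v = s} * emeasure (reward_measure r) {R. R a}"
      by (intro R.emeasure_pair_measure_Times m sets_reward_measure)
    moreover have "emeasure (noise_measure r) ?S = emeasure unit_uniform {u. select_arm q u = a}
        * emeasure (unit_uniform \<Otimes>\<^sub>M reward_measure r) ({v. tiebreak q v = s} \<times> {R. R a})"
      unfolding S noise_measure_def
      by (intro UR.emeasure_pair_measure_Times m pair_measureI sets_reward_measure)
    ultimately show ?thesis
      using emeasure_select_arm[OF q, of a] emeasure_reward[of r a] r
      unfolding tie_prob_def U.emeasure_eq_measure[of "{v. tiebreak q v = s}"] by simp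
  qed
  also have "\<dots> = ennreal (q a * (tie_prob q s * r a))"
    using prob_vec_pos[OF q, of a] r[of a] tie_prob_nonneg[of q s] by (simp add: ennreal_mult)
  finally show "measure (noise_measure r) ?S = q a * (tie_prob q s * r a)"
    using prob_vec_pos[OF q, of a] r[of a] tie_prob_nonneg[of q s]
    by (simp add: measure_def)
qed

text \<open>Up to the constant \<open>c\<close>, the function \<open>h\<close> is a finite linear
  combination of indicators of the rectangles above, so it can be integrated term by term.\<close>

lemma integral_noise_reward:
  fixes f :: "'a::{finite,linorder} \<Rightarrow> 'a \<Rightarrow> real" and c :: real
  assumes q: "prob_vec q" and r: "\<And>a. 0 \<le> r a \<and> r a \<le> 1"
  defines "h \<equiv> \<lambda>w. if snd (snd w) (select_arm q (fst w))
      then f (tiebreak q (fst (snd w))) (select_arm q (fst w)) else c"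
  shows "integrable (noise_measure r) h"
    and "(\<integral>w. h w \<partial>noise_measure r)
      = c + (\<Sum>s\<in>UNIV. tie_prob q s * (\<Sum>a\<in>UNIV. q a * r a * (f s a - c)))"
proof -
  interpret prob_space "noise_measure r" by (rule prob_space_noise_measure)
  define S where "S = (\<lambda>s a. {w :: 'a noise. select_arm q (fst w) = a \<and>
      tiebreak q (fst (snd w)) = s \<and> snd (snd w) a})"
  have S: "S s a \<in> sets (noise_measure r)" "prob (S s a) = q a * (tie_prob q s * r a)" for s a
    using measure_noise_rectangle[OF q r] by (simp_all add: S_def)
  have h: "h = (\<lambda>w. c + (\<Sum>s\<in>UNIV. \<Sum>a\<in>UNIV. (f s a - c) * indicator (S s a) w))"
  proof
    fix w :: "'a noise"
    define s0 a0 where "s0 = tiebreak q (fst (snd w))" and "a0 = select_arm q (fst w)"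
    have "(f s a - c) * indicator (S s a) w
      = (if a = a0 then if s = s0 then if snd (snd w) a0 then f s0 a0 - c else 0 else 0 else 0)" for s a
      by (auto simp: S_def s0_def a0_def indicator_def)
    then have "(\<Sum>s\<in>UNIV. \<Sum>a\<in>UNIV. (f s a - c) * indicator (S s a) w)
      = (if snd (snd w) a0 then f s0 a0 - c else 0)" by simp
    then show "h w = c + (\<Sum>s\<in>UNIV. \<Sum>a\<in>UNIV. (f s a - c) * indicator (S s a) w)"
      by (simp add: h_def s0_def a0_def)
  qed
  have int: "integrable (noise_measure r) (\<lambda>w. (f s a - c) * indicator (S s a) w)" for s a
    using S(1) by (intro integrable_mult_right integrable_real_indicator) (auto simp: emeasure_eq_measure)
  show "integrable (noise_measure r) h" unfolding h by (intro Bochner_Integration.integrable_add integrable_const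
      Bochner_Integration.integrable_sum int)
  have "(\<integral>w. h w \<partial>noise_measure r) = c + (\<Sum>s\<in>UNIV. \<Sum>a\<in>UNIV. (f s a - c) * (q a * (tie_prob q s * r a)))"
  proof -
    have "(\<integral>w. h w \<partial>noise_measure r) = (\<integral>w. c \<partial>noise_measure r)
        + (\<integral>w. (\<Sum>s\<in>UNIV. \<Sum>a\<in>UNIV. (f s a - c) * indicator (S s a) w) \<partial>noise_measure r)"
      unfolding h by (intro Bochner_Integration.integral_add integrable_const
          Bochner_Integration.integrable_sum int)
    also have "(\<integral>w. (\<Sum>s\<in>UNIV. \<Sum>a\<in>UNIV. (f s a - c) * indicator (S s a) w) \<partial>noise_measure r)
        = (\<Sum>s\<in>UNIV. \<Sum>a\<in>UNIV. (\<integral>w. (f s a - c) * indicator (S s a) w \<partial>noise_measure r))"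
      by (subst Bochner_Integration.integral_sum, intro Bochner_Integration.integrable_sum int)
        (intro sum.cong refl Bochner_Integration.integral_sum int)
    also have "\<dots> = (\<Sum>s\<in>UNIV. \<Sum>a\<in>UNIV. (f s a - c) * (q a * (tie_prob q s * r a)))"
      using S by (intro sum.cong refl) simp
    finally show ?thesis by (simp add: prob_space)
  qed
  then show "(\<integral>w. h w \<partial>noise_measure r)
      = c + (\<Sum>s\<in>UNIV. tie_prob q s * (\<Sum>a\<in>UNIV. q a * r a * (f s a - c)))"
    by (simp add: sum_distrib_left mult_ac)
qed

lemma (in bandit) integral_samba_step:
  fixes f :: "('a \<Rightarrow> real) \<Rightarrow> real"
  assumes q: "prob_vec q"
  shows "integrable (noise_measure r) (\<lambda>w. f (samba_step (alpha_log \<beta>) q w))"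
    and "(\<integral>w. f (samba_step (alpha_log \<beta>) q w) \<partial>noise_measure r)
      = f q + (\<Sum>s\<in>UNIV. tie_prob q s * reward_drift f q s)"
proof -
  have *: "(\<lambda>w. f (samba_step (alpha_log \<beta>) q w)) =
     (\<lambda>w. if snd (snd w) (select_arm q (fst w))
       then f (samba_update (alpha_log \<beta>) q (tiebreak q (fst (snd w))) (select_arm q (fst w))) else f q)"
  proof
    fix w :: "'a noise"
    show "f (samba_step (alpha_log \<beta>) q w) = (if snd (snd w) (select_arm q (fst w))
       then f (samba_update (alpha_log \<beta>) q (tiebreak q (fst (snd w))) (select_arm q (fst w))) else f q)"
      by (cases w) (simp add: samba_step_eq[OF q])
  qed
  show "integrable (noise_measure r) (\<lambda>w. f (samba_step (alpha_log \<beta>) q w))"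
    unfolding * by (rule integral_noise_reward(1)[OF q reward_bounds])
  show "(\<integral>w. f (samba_step (alpha_log \<beta>) q w) \<partial>noise_measure r)
      = f q + (\<Sum>s\<in>UNIV. tie_prob q s * reward_drift f q s)"
    unfolding * reward_drift_def
    using integral_noise_reward(2)[OF q reward_bounds,
      where f="\<lambda>s a. f (samba_update (alpha_log \<beta>) q s a)" and c="f q"] by simp
qed

lemma (in bandit) integral_played_reward:
  assumes q: "prob_vec q"
  shows "integrable (noise_measure r) (played_reward q)"
    and "(\<integral>w. played_reward q w \<partial>noise_measure r) = (\<Sum>a\<in>UNIV. q a * r a)"
proof -
  have *: "played_reward q = (\<lambda>w. if snd (snd w) (select_arm q (fst w)) then 1 else 0)"
    by (auto simp: played_reward_def fun_eq_iff)
  show "integrable (noise_measure r) (played_reward q)"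
    unfolding * using integral_noise_reward(1)[OF q reward_bounds, where f="\<lambda>s a. 1" and c=0] .
  show "(\<integral>w. played_reward q w \<partial>noise_measure r) = (\<Sum>a\<in>UNIV. q a * r a)"
    unfolding * using integral_noise_reward(2)[OF q reward_bounds, where f="\<lambda>s a. 1" and c=0]
    by (simp add: sum_distrib_right[symmetric] sum_tie_prob)
qed

text \<open>The discrete sigma-algebra on the uncountable state space causes no trouble, since a
  step from a fixed \<open>q\<close> has finitely many outcomes.\<close>

lemma measurable_samba_step:
  assumes q: "prob_vec q"
  shows "samba_step \<alpha> q \<in> noise_measure r \<rightarrow>\<^sub>M count_space UNIV"
proof -
  have "samba_step \<alpha> q = (\<lambda>w. (\<lambda>a s R. if R a then samba_update \<alpha> q s a else q)
      (select_arm q (fst w)) (tiebreak q (fst (snd w))) (snd (snd w)))"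
    using samba_step_eq[OF q] by (auto simp: fun_eq_iff)
  then show ?thesis using measurable_noise_function[of "\<lambda>a s R. if R a then samba_update \<alpha> q s a else q"]
    by simp
qed

section \<open>The process and its past\<close>

locale samba = bandit r astar \<beta> + prob_space M
  for r :: "'a::{finite,linorder} \<Rightarrow> real" and astar :: 'a and \<beta> :: real and M :: "'w measure" +
  fixes \<xi> :: "nat \<Rightarrow> 'w \<Rightarrow> 'a noise" and p0 :: "'a \<Rightarrow> real"
  assumes indep: "indep_vars (\<lambda>_. noise_measure r) \<xi> UNIV"
    and ident: "\<And>t. distr M (noise_measure r) (\<xi> t) = noise_measure r"
    and init: "prob_vec p0"
begin

abbreviation X :: "nat \<Rightarrow> 'w \<Rightarrow> 'a \<Rightarrow> real" where
  "X \<equiv> samba_X (alpha_log \<beta>) p0 \<xi>"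

lemma X_0: "X 0 \<omega> = p0"
  by (simp add: samba_X_def)

lemma X_Suc: "X (Suc t) \<omega> = samba_step (alpha_log \<beta>) (X t \<omega>) (\<xi> t \<omega>)"
  by (simp add: samba_X_def)

lemma X_Suc_cases:
  assumes "prob_vec (X t \<omega>)"
  obtains "X (Suc t) \<omega> = X t \<omega>"
  | s a where "s \<in> maxset (X t \<omega>)" "X (Suc t) \<omega> = samba_update (alpha_log \<beta>) (X t \<omega>) s a"
proof -
  obtain u v R where w: "\<xi> t \<omega> = (u, v, R)" by (cases "\<xi> t \<omega>")
  show ?thesis
  proof (cases "R (select_arm (X t \<omega>) u)")
    case True
    then show ?thesis
      by (intro that(2)[OF tiebreak_in_maxset]) (simp add: X_Suc w samba_step_eq[OF assms])
  next
    case False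
    then show ?thesis by (intro that(1)) (simp add: X_Suc w samba_step_eq[OF assms])
  qed
qed

lemma prob_vec_X: "prob_vec (X t \<omega>)"
proof (induction t)
  case (Suc t)
  show ?case
    using X_Suc_cases[OF Suc] prob_vec_samba_update[OF Suc _ rate_pos rate_le_1] Suc by metis
qed (simp add: X_0 init)

lemma X_pos: "0 < X t \<omega> a" and X_le_1: "X t \<omega> a \<le> 1"
  by (rule prob_vec_pos[OF prob_vec_X], rule prob_vec_le_1[OF prob_vec_X])

text \<open>Finitely many successors per state, iterated from \<open>p0\<close>. Finite range makes
  functions of the state integrable and turns conditioning on \<open>X t\<close> into finite
  sums.\<close>

lemma finite_range_X: "finite (range (X t))"
proof (induction t)
  case (Suc t)
  have "range (X (Suc t)) \<subseteq> (\<Union>q\<in>range (X t). insert q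
      ((\<lambda>(s, a). samba_update (alpha_log \<beta>) q s a) ` UNIV))"
  proof
    fix q' assume "q' \<in> range (X (Suc t))"
    then obtain \<omega> where q': "q' = X (Suc t) \<omega>" by auto
    show "q' \<in> (\<Union>q\<in>range (X t). insert q ((\<lambda>(s, a). samba_update (alpha_log \<beta>) q s a) ` UNIV))"
      by (rule X_Suc_cases[OF prob_vec_X, of t \<omega>]) (auto simp: q' intro!: exI[of _ \<omega>])
  qed
  moreover have "finite (\<Union>q\<in>range (X t). insert q
      ((\<lambda>(s, a). samba_update (alpha_log \<beta>) q s a) ` UNIV))"
    using Suc by (intro finite_UN_I) auto
  ultimately show ?case by (rule finite_subset)
qed (simp add: X_0)

section \<open>The filtration of the noise and the Markov property\<close>

text \<open>The sigma-algebra generated by the noise strictly before \<open>t\<close>: it determines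
  \<open>X t\<close> and is independent of \<open>\<xi> t\<close>.\<close>

definition past :: "nat \<Rightarrow> 'w measure" where
  "past t = vimage_algebra (space M) (\<lambda>\<omega>. restrict (\<lambda>i. \<xi> i \<omega>) {..<t})
     (Pi\<^sub>M {..<t} (\<lambda>_. noise_measure r))"

lemma measurable_noise: "\<xi> t \<in> M \<rightarrow>\<^sub>M noise_measure r"
  using indep by (auto simp: indep_vars_def)

lemma space_past [simp]: "space (past t) = space M"
  by (simp add: past_def)

lemma restrict_noise_space:
  "(\<lambda>\<omega>. restrict (\<lambda>i. \<xi> i \<omega>) I) \<in> space M \<rightarrow> space (Pi\<^sub>M I (\<lambda>_. noise_measure r))"
  by (auto simp: space_PiM space_noise_measure)

lemma measurable_noise_past: "i < t \<Longrightarrow> \<xi> i \<in> past t \<rightarrow>\<^sub>M noise_measure r"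
proof -
  assume i: "i < t"
  have "(\<lambda>\<omega>. (restrict (\<lambda>i. \<xi> i \<omega>) {..<t}) i) \<in> past t \<rightarrow>\<^sub>M noise_measure r"
    unfolding past_def
    by (rule measurable_compose[OF measurable_vimage_algebra1[OF restrict_noise_space]
          measurable_component_singleton]) (use i in simp)
  then show ?thesis using i by simp
qed

lemma past_sets_iff:
  "A \<in> sets (past t) \<longleftrightarrow> (\<exists>B\<in>sets (Pi\<^sub>M {..<t} (\<lambda>_. noise_measure r)).
     A = (\<lambda>\<omega>. restrict (\<lambda>i. \<xi> i \<omega>) {..<t}) -` B \<inter> space M)"
  unfolding past_def sets_vimage_algebra2[OF restrict_noise_space] by auto

lemma past_sets_subset: "A \<in> sets (past t) \<Longrightarrow> A \<in> events"
proof -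
  have "(\<lambda>\<omega>. restrict (\<lambda>i. \<xi> i \<omega>) {..<t}) \<in> M \<rightarrow>\<^sub>M Pi\<^sub>M {..<t} (\<lambda>_. noise_measure r)"
    by (intro measurable_restrict measurable_noise)
  then show "A \<in> sets (past t) \<Longrightarrow> A \<in> events" by (auto simp: past_sets_iff)
qed

text \<open>The step is measurable in the noise for each fixed state; splitting along the finitely
  many values of \<open>X i\<close> yields measurability of the composition.\<close>

lemma measurable_X_past: "i \<le> t \<Longrightarrow> X i \<in> past t \<rightarrow>\<^sub>M count_space UNIV"
proof (induction i)
  case 0
  have "X 0 = (\<lambda>_. p0)" by (auto simp: X_0)
  then show ?case by simp
next
  case (Suc i)
  then have "X i \<in> past t \<rightarrow>\<^sub>M count_space UNIV" by simp
  then have Xi: "X i \<in> past t \<rightarrow>\<^sub>M count_space (range (X i))"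
    by (auto simp: measurable_def)
  have "(\<lambda>\<omega>. samba_step (alpha_log \<beta>) (X i \<omega>) (\<xi> i \<omega>)) \<in> past t \<rightarrow>\<^sub>M count_space UNIV"
  proof (rule measurable_compose_countable'[OF _ Xi])
    fix q assume "q \<in> range (X i)"
    then have "prob_vec q" using prob_vec_X by auto
    then show "(\<lambda>\<omega>. samba_step (alpha_log \<beta>) q (\<xi> i \<omega>)) \<in> past t \<rightarrow>\<^sub>M count_space UNIV"
      using measurable_compose[OF measurable_noise_past measurable_samba_step] Suc.prems by simp
  qed (simp add: countable_finite finite_range_X)
  then show ?case by (simp add: X_Suc[abs_def])
qed

lemma measurable_X: "X t \<in> M \<rightarrow>\<^sub>M count_space UNIV"
proof (rule measurableI)
  fix A :: "('a \<Rightarrow> real) set" assume "A \<in> sets (count_space UNIV)"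
  then have "X t -` A \<inter> space (past t) \<in> sets (past t)"
    by (rule measurable_sets[OF measurable_X_past[OF order_refl]])
  from past_sets_subset[OF this] show "X t -` A \<inter> space M \<in> events" by simp
qed simp

lemma X_event_past: "i \<le> t \<Longrightarrow> {\<omega>\<in>space M. P (X i \<omega>)} \<in> sets (past t)"
  using measurable_sets[OF measurable_X_past, of i t "{q. P q}"]
  by (simp add: vimage_def Int_def conj_commute)

text \<open>A past event is the preimage of a set of noise sequences before \<open>t\<close>. By
  independence from \<open>\<xi> t\<close>, the expectation of the product factorises.\<close>

lemma integral_past_noise:
  fixes g :: "'a noise \<Rightarrow> real"
  assumes A: "A \<in> sets (past t)" and g: "integrable (noise_measure r) g"
  shows "integrable M (\<lambda>\<omega>. g (\<xi> t \<omega>))"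
    and "(\<integral>\<omega>. indicator A \<omega> * g (\<xi> t \<omega>) \<partial>M) = prob A * (\<integral>w. g w \<partial>noise_measure r)"
proof -
  have gm: "g \<in> borel_measurable (noise_measure r)" using g by simp
  have gd: "integrable (distr M (noise_measure r) (\<xi> t)) g" using g by (simp add: ident)
  then show int: "integrable M (\<lambda>\<omega>. g (\<xi> t \<omega>))"
    using integrable_distr[OF measurable_noise] by blast
  obtain B where B: "B \<in> sets (Pi\<^sub>M {..<t} (\<lambda>_. noise_measure r))"
    "A = (\<lambda>\<omega>. restrict (\<lambda>i. \<xi> i \<omega>) {..<t}) -` B \<inter> space M"
    using A past_sets_iff by auto
  have "indep_var (Pi\<^sub>M {..<t} (\<lambda>_. noise_measure r)) (\<lambda>\<omega>. restrict (\<lambda>i. \<xi> i \<omega>) {..<t})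
      (Pi\<^sub>M {t} (\<lambda>_. noise_measure r)) (\<lambda>\<omega>. restrict (\<lambda>i. \<xi> i \<omega>) {t})"
    by (rule indep_var_restrict[OF indep]) auto
  moreover have "(\<lambda>x. g (x t)) \<in> borel_measurable (Pi\<^sub>M {t} (\<lambda>_. noise_measure r))"
    by (rule measurable_compose[OF _ gm]) simp
  ultimately have "indep_var borel ((indicator B :: _ \<Rightarrow> real) \<circ> (\<lambda>\<omega>. restrict (\<lambda>i. \<xi> i \<omega>) {..<t}))
      borel ((\<lambda>x. g (x t)) \<circ> (\<lambda>\<omega>. restrict (\<lambda>i. \<xi> i \<omega>) {t}))"
    using B(1) by (intro indep_var_compose) auto
  then have ind: "indep_var borel (\<lambda>\<omega>. indicator B (restrict (\<lambda>i. \<xi> i \<omega>) {..<t}) :: real)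
      borel (\<lambda>\<omega>. g (\<xi> t \<omega>))"
    by (simp add: comp_def)
  have iA: "indicator B (restrict (\<lambda>i. \<xi> i \<omega>) {..<t}) = (indicator A \<omega> :: real)" if "\<omega> \<in> space M" for \<omega>
    using that by (auto simp: B(2) indicator_def)
  have Am: "A \<in> events" using A by (rule past_sets_subset)
  have "integrable M (\<lambda>\<omega>. indicator A \<omega> :: real)"
    using Am by (intro integrable_real_indicator) (auto simp: emeasure_eq_measure)
  then have iint: "integrable M (\<lambda>\<omega>. indicator B (restrict (\<lambda>i. \<xi> i \<omega>) {..<t}) :: real)"
    by (subst Bochner_Integration.integrable_cong[OF refl iA]) auto
  have "(\<integral>\<omega>. indicator A \<omega> * g (\<xi> t \<omega>) \<partial>M)
      = (\<integral>\<omega>. indicator B (restrict (\<lambda>i. \<xi> i \<omega>) {..<t}) * g (\<xi> t \<omega>) \<partial>M)"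
    by (intro Bochner_Integration.integral_cong refl) (simp add: iA)
  also have "\<dots> = (\<integral>\<omega>. indicator B (restrict (\<lambda>i. \<xi> i \<omega>) {..<t}) \<partial>M) * (\<integral>\<omega>. g (\<xi> t \<omega>) \<partial>M)"
    by (rule indep_var_lebesgue_integral[OF ind iint int])
  also have "(\<integral>\<omega>. (indicator B (restrict (\<lambda>i. \<xi> i \<omega>) {..<t}) :: real) \<partial>M) = (\<integral>\<omega>. indicator A \<omega> \<partial>M)"
    by (intro Bochner_Integration.integral_cong refl) (simp add: iA)
  also have "\<dots> = prob A" using Am by simp
  also have "(\<integral>\<omega>. g (\<xi> t \<omega>) \<partial>M) = (\<integral>w. g w \<partial>distr M (noise_measure r) (\<xi> t))"
    by (rule integral_distr[OF measurable_noise gm, symmetric])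
  finally show "(\<integral>\<omega>. indicator A \<omega> * g (\<xi> t \<omega>) \<partial>M) = prob A * (\<integral>w. g w \<partial>noise_measure r)"
    by (simp add: ident)
qed

text \<open>On an event that fixes the present state, the next state is a function of fresh noise
  alone, so the rest of the history enters only through \<open>prob A\<close>.\<close>

lemma prob_past_step:
  assumes A: "A \<in> sets (past t)" and sub: "\<And>\<omega>. \<omega> \<in> A \<Longrightarrow> X t \<omega> = q"
  shows "prob (A \<inter> {\<omega>\<in>space M. X (Suc t) \<omega> = y})
    = prob A * measure (noise_measure r) {w. samba_step (alpha_log \<beta>) q w = y}"
proof (cases "A = {}")
  case False
  then obtain \<omega>0 where "X t \<omega>0 = q" using sub by auto
  then have q: "prob_vec q" using prob_vec_X by auto
  interpret N: prob_space "noise_measure r" by (rule prob_space_noise_measure)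
  define S where "S = {w. samba_step (alpha_log \<beta>) q w = y}"
  have S: "S \<in> sets (noise_measure r)"
    using measurable_sets[OF measurable_samba_step[OF q], of "{y}" "alpha_log \<beta>" r]
    by (simp add: S_def vimage_def space_noise_measure)
  have Am: "A \<in> events" using A by (rule past_sets_subset)
  have B: "A \<inter> {\<omega>\<in>space M. X (Suc t) \<omega> = y} \<in> events"
    using Am past_sets_subset[OF X_event_past[of "Suc t" "Suc t" "\<lambda>x. x = y"]] by auto
  have "prob (A \<inter> {\<omega>\<in>space M. X (Suc t) \<omega> = y})
      = (\<integral>\<omega>. indicator (A \<inter> {\<omega>\<in>space M. X (Suc t) \<omega> = y}) \<omega> \<partial>M)"
    using B by simp
  also have "\<dots> = (\<integral>\<omega>. indicator A \<omega> * indicator S (\<xi> t \<omega>) \<partial>M)"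
    by (intro Bochner_Integration.integral_cong refl)
      (auto simp: indicator_def S_def X_Suc sub)
  also have "\<dots> = prob A * (\<integral>w. indicator S w \<partial>noise_measure r)"
    using S by (intro integral_past_noise A integrable_real_indicator) (auto simp: N.emeasure_eq_measure)
  also have "\<dots> = prob A * measure (noise_measure r) S" using S by simp
  finally show ?thesis by (simp add: S_def)
qed simp

text \<open>The full history and the present alone yield the same transition probability from
  \<open>xs t\<close> to \<open>y\<close>. The cross-multiplied form avoids conditioning on null
  events.\<close>

lemma markov_property:
  "prob {\<omega>\<in>space M. (\<forall>i\<le>t. X i \<omega> = xs i) \<and> X (Suc t) \<omega> = y} * prob {\<omega>\<in>space M. X t \<omega> = xs t}
   = prob {\<omega>\<in>space M. \<forall>i\<le>t. X i \<omega> = xs i} * prob {\<omega>\<in>space M. X t \<omega> = xs t \<and> X (Suc t) \<omega> = y}"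
proof -
  let ?A = "{\<omega>\<in>space M. \<forall>i\<le>t. X i \<omega> = xs i}" and ?B = "{\<omega>\<in>space M. X t \<omega> = xs t}"
  let ?Y = "{\<omega>\<in>space M. X (Suc t) \<omega> = y}"
  have "?A = (\<Inter>i\<in>{..t}. {\<omega>\<in>space M. X i \<omega> = xs i})" by auto
  then have A: "?A \<in> sets (past t)"
    using X_event_past[of _ t "\<lambda>q. q = _"] by (auto intro!: sets.finite_INT)
  have B: "?B \<in> sets (past t)" using X_event_past[of t t "\<lambda>q. q = xs t"] by simp
  have "{\<omega>\<in>space M. (\<forall>i\<le>t. X i \<omega> = xs i) \<and> X (Suc t) \<omega> = y} = ?A \<inter> ?Y"
    "{\<omega>\<in>space M. X t \<omega> = xs t \<and> X (Suc t) \<omega> = y} = ?B \<inter> ?Y" by auto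
  then show ?thesis
    using prob_past_step[OF A, of "xs t" y] prob_past_step[OF B, of "xs t" y] by simp
qed

section \<open>Expectations restricted to past events\<close>

text \<open>Expectation of \<open>f (X t)\<close> on the event \<open>A\<close>. With
  \<open>A\<close> ranging over past events, such integrals take the place of conditional
  expectations.\<close>

definition E :: "'w set \<Rightarrow> (('a \<Rightarrow> real) \<Rightarrow> real) \<Rightarrow> nat \<Rightarrow> real" where
  "E A f t = (\<integral>\<omega>. indicator A \<omega> * f (X t \<omega>) \<partial>M)"

lemma E_integrable:
  fixes f :: "('a \<Rightarrow> real) \<Rightarrow> real"
  assumes "A \<in> events" shows "integrable M (\<lambda>\<omega>. indicator A \<omega> * f (X t \<omega>))"
proof -
  have "(\<lambda>\<omega>. f (X t \<omega>)) \<in> borel_measurable M"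
    by (rule measurable_compose[OF measurable_X]) simp
  moreover have "norm (f (X t \<omega>)) \<le> Max ((\<lambda>q. \<bar>f q\<bar>) ` range (X t))" for \<omega>
    using finite_range_X[of t] by (auto intro!: Max_ge)
  ultimately have "integrable M (\<lambda>\<omega>. f (X t \<omega>))"
    by (intro integrable_const_bound[of _ "Max ((\<lambda>q. \<bar>f q\<bar>) ` range (X t))"]) auto
  then show ?thesis using assms by (rule integrable_mult_indicator[where 'b=real, simplified, rotated])
qed

lemma E_mono:
  assumes "A \<in> events" "\<And>\<omega>. \<omega> \<in> A \<Longrightarrow> f (X t \<omega>) \<le> g (X t \<omega>)"
  shows "E A f t \<le> E A g t"
  unfolding E_def using assms
  by (intro integral_mono E_integrable) (auto simp: indicator_def)

lemma E_nonneg: "(\<And>\<omega>. 0 \<le> f (X t \<omega>)) \<Longrightarrow> 0 \<le> E A f t"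
  unfolding E_def by (intro Bochner_Integration.integral_nonneg) (auto simp: indicator_def)

lemma E_const: "A \<in> events \<Longrightarrow> E A (\<lambda>_. c) t = c * prob A"
  unfolding E_def by simp

lemma E_add: "A \<in> events \<Longrightarrow> E A (\<lambda>q. f q + g q) t = E A f t + E A g t"
  unfolding E_def distrib_left by (intro Bochner_Integration.integral_add E_integrable)

lemma E_cmult: "A \<in> events \<Longrightarrow> E A (\<lambda>q. c * f q) t = c * E A f t"
  unfolding E_def mult.left_commute[of _ c] by (rule integral_mult_right_zero)

lemma E_Un:
  assumes "A \<in> events" "B \<in> events" "A \<inter> B = {}"
  shows "E (A \<union> B) f t = E A f t + E B f t"
proof -
  have "E (A \<union> B) f t = (\<integral>\<omega>. indicator A \<omega> * f (X t \<omega>) + indicator B \<omega> * f (X t \<omega>) \<partial>M)"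
    unfolding E_def using assms(3)
    by (intro Bochner_Integration.integral_cong refl) (auto simp: indicator_def)
  also have "\<dots> = E A f t + E B f t"
    unfolding E_def by (intro Bochner_Integration.integral_add E_integrable assms)
  finally show ?thesis .
qed

text \<open>Splitting \<open>A\<close> by the value of \<open>X t\<close> freezes the first argument
  of \<open>F\<close>; on each piece the noise is integrated out by independence.\<close>

lemma integral_past_step:
  fixes F :: "('a \<Rightarrow> real) \<Rightarrow> 'a noise \<Rightarrow> real"
  assumes A: "A \<in> sets (past t)" and F: "\<And>q. prob_vec q \<Longrightarrow> integrable (noise_measure r) (F q)"
  shows "integrable M (\<lambda>\<omega>. indicator A \<omega> * F (X t \<omega>) (\<xi> t \<omega>))"
    and "(\<integral>\<omega>. indicator A \<omega> * F (X t \<omega>) (\<xi> t \<omega>) \<partial>M) = E A (\<lambda>q. \<integral>w. F q w \<partial>noise_measure r) t"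
proof -
  define B where "B = (\<lambda>q. A \<inter> {\<omega>\<in>space M. X t \<omega> = q})"
  have B: "B q \<in> sets (past t)" for q
    unfolding B_def using A X_event_past[of t t "\<lambda>x. x = q"] by auto
  have Be: "B q \<in> events" for q using past_sets_subset[OF B] .
  have sp: "indicator A \<omega> * G (X t \<omega>) = (\<Sum>q\<in>range (X t). indicator (B q) \<omega> * G q)"
    if "\<omega> \<in> space M" for \<omega> and G :: "('a \<Rightarrow> real) \<Rightarrow> real"
  proof -
    have "(\<Sum>q\<in>range (X t). indicator (B q) \<omega> * G q)
        = (\<Sum>q\<in>range (X t). if q = X t \<omega> then indicator A \<omega> * G q else 0)"
      using that by (intro sum.cong) (auto simp: B_def indicator_def)
    then show ?thesis using finite_range_X by simp
  qed
  have Fq: "integrable (noise_measure r) (F q)" if "q \<in> range (X t)" for q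
    using F prob_vec_X that by auto
  have int: "integrable M (\<lambda>\<omega>. indicator (B q) \<omega> * F q (\<xi> t \<omega>))" if "q \<in> range (X t)" for q
    using integral_past_noise(1)[OF B Fq[OF that]] Be
    by (rule integrable_mult_indicator[where 'b=real, simplified, rotated])
  have "integrable M (\<lambda>\<omega>. \<Sum>q\<in>range (X t). indicator (B q) \<omega> * F q (\<xi> t \<omega>))"
    by (intro Bochner_Integration.integrable_sum int)
  then show "integrable M (\<lambda>\<omega>. indicator A \<omega> * F (X t \<omega>) (\<xi> t \<omega>))"
    by (subst Bochner_Integration.integrable_cong[OF refl sp])
  have "(\<integral>\<omega>. indicator A \<omega> * F (X t \<omega>) (\<xi> t \<omega>) \<partial>M)
      = (\<integral>\<omega>. (\<Sum>q\<in>range (X t). indicator (B q) \<omega> * F q (\<xi> t \<omega>)) \<partial>M)"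
    by (intro Bochner_Integration.integral_cong refl sp)
  also have "\<dots> = (\<Sum>q\<in>range (X t). (\<integral>\<omega>. indicator (B q) \<omega> * F q (\<xi> t \<omega>) \<partial>M))"
    by (intro Bochner_Integration.integral_sum int)
  also have "\<dots> = (\<Sum>q\<in>range (X t). prob (B q) * (\<integral>w. F q w \<partial>noise_measure r))"
    by (intro sum.cong refl integral_past_noise(2) B Fq)
  also have "\<dots> = (\<Sum>q\<in>range (X t). (\<integral>\<omega>. indicator (B q) \<omega> * (\<integral>w. F q w \<partial>noise_measure r) \<partial>M))"
    using Be by (intro sum.cong refl) simp
  also have "\<dots> = (\<integral>\<omega>. (\<Sum>q\<in>range (X t). indicator (B q) \<omega> * (\<integral>w. F q w \<partial>noise_measure r)) \<partial>M)"
    using Be by (intro Bochner_Integration.integral_sum[symmetric] integrable_mult_left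
        integrable_real_indicator) (auto simp: emeasure_eq_measure)
  also have "\<dots> = E A (\<lambda>q. \<integral>w. F q w \<partial>noise_measure r) t"
    unfolding E_def by (intro Bochner_Integration.integral_cong refl sp[symmetric])
  finally show "(\<integral>\<omega>. indicator A \<omega> * F (X t \<omega>) (\<xi> t \<omega>) \<partial>M)
      = E A (\<lambda>q. \<integral>w. F q w \<partial>noise_measure r) t" .
qed

text \<open>The conditional one-step change is an average of \<open>reward_drift\<close> over the
  leaders. Non-maximisers have \<open>tie_prob\<close> 0, so the bound is demanded for maximisers
  only.\<close>

lemma E_Suc_le:
  assumes A: "A \<in> sets (past t)"
    and drift: "\<And>\<omega> s. \<omega> \<in> A \<Longrightarrow> s \<in> maxset (X t \<omega>) \<Longrightarrow> reward_drift f (X t \<omega>) s \<le> g (X t \<omega>)"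
  shows "E A f (Suc t) \<le> E A f t + E A g t"
proof -
  have "E A f (Suc t) = (\<integral>\<omega>. indicator A \<omega> * f (samba_step (alpha_log \<beta>) (X t \<omega>) (\<xi> t \<omega>)) \<partial>M)"
    unfolding E_def by (simp add: X_Suc)
  also have "\<dots> = E A (\<lambda>q. \<integral>w. f (samba_step (alpha_log \<beta>) q w) \<partial>noise_measure r) t"
    by (rule integral_past_step[OF A integral_samba_step(1)])
  also have "\<dots> \<le> E A (\<lambda>q. f q + g q) t"
  proof (rule E_mono)
    fix \<omega> assume \<omega>: "\<omega> \<in> A"
    let ?q = "X t \<omega>"
    have "(\<Sum>s\<in>UNIV. tie_prob ?q s * reward_drift f ?q s) \<le> (\<Sum>s\<in>UNIV. tie_prob ?q s * g ?q)"
    proof (rule sum_mono)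
      fix s
      show "tie_prob ?q s * reward_drift f ?q s \<le> tie_prob ?q s * g ?q"
        by (cases "s \<in> maxset ?q")
          (auto simp: tie_prob_outside tie_prob_nonneg intro: mult_left_mono drift[OF \<omega>])
    qed
    also have "\<dots> = g ?q" by (simp add: sum_distrib_right[symmetric] sum_tie_prob)
    finally show "(\<integral>w. f (samba_step (alpha_log \<beta>) ?q w) \<partial>noise_measure r) \<le> f ?q + g ?q"
      using integral_samba_step(2)[OF prob_vec_X] by simp
  qed (rule past_sets_subset[OF A])
  finally show ?thesis using E_add past_sets_subset[OF A] by simp
qed

end

section \<open>Almost sure convergence\<close>

context bandit
begin

lemma reward_drift_loss:
  "reward_drift (\<lambda>q. 1 - q astar) q s = - reward_drift (\<lambda>q. q astar) q s"
  unfolding reward_drift_def sum_negf[symmetric] by (intro sum.cong) (simp_all add: algebra_simps)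

lemma leader_if_gt_half:
  assumes "prob_vec q" "1 / 2 < q astar" "s \<in> maxset q" shows "s = astar"
proof (rule ccontr)
  assume "s \<noteq> astar"
  then have "q s + q astar \<le> 1" using prob_vec_add_le_1 assms by blast
  moreover have "q astar \<le> q s" using assms by (simp add: maxset_def)
  ultimately show False using assms(2) by simp
qed

text \<open>A leader has at least the average entry \<open>1 / CARD('a)\<close>.\<close>

lemma not_leader_if_small:
  assumes "prob_vec q" "q astar < 1 / real CARD('a)" "s \<in> maxset q" shows "s \<noteq> astar"
proof
  assume "s = astar"
  then have "(\<Sum>a\<in>UNIV. q a) < (\<Sum>a\<in>(UNIV :: 'a set). 1 / real CARD('a))"
    using assms by (intro sum_strict_mono) (auto simp: maxset_def intro: le_less_trans)
  then show False using assms(1) two_arms by (simp add: prob_vec_def)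
qed

lemma alpha_log_small:
  obtains \<delta> where "0 < \<delta>" "\<And>p. 0 < p \<Longrightarrow> p \<le> \<delta> \<Longrightarrow> alpha_log \<beta> p \<le> gap / 2"
proof
  \<comment> \<open>The solution of \<open>alpha_log \<beta> \<delta> = gap / 2\<close>.\<close>
  define \<delta> where "\<delta> = exp (1 - 2 * \<beta> / gap)"
  show "0 < \<delta>" by (simp add: \<delta>_def)
  fix p assume p: "0 < p" "p \<le> \<delta>"
  have "ln p \<le> ln \<delta>" using p by simp
  then have l: "2 * \<beta> / gap \<le> 1 - ln p" by (simp add: \<delta>_def)
  moreover have "0 < 2 * \<beta> / gap" using rate_pos gap_pos by simp
  ultimately have "0 < 1 - ln p" by linarith
  moreover have "2 * \<beta> \<le> (1 - ln p) * gap" using l gap_pos by (simp add: field_simps)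
  ultimately show "alpha_log \<beta> p \<le> gap / 2" unfolding alpha_log_def by (simp add: field_simps)
qed

end

context samba
begin

lemma E_loss_Suc_le:
  assumes A: "A \<in> sets (past t)"
  shows "E A (\<lambda>q. 1 - q astar) (Suc t) \<le> E A (\<lambda>q. 1 - q astar) t
    - gap * \<beta> * E A (\<lambda>q. log_rate (min (q astar) (1 - q astar) / real CARD('a))) t"
proof -
  have "E A (\<lambda>q. 1 - q astar) (Suc t) \<le> E A (\<lambda>q. 1 - q astar) t
    + E A (\<lambda>q. - (gap * \<beta>) * log_rate (min (q astar) (1 - q astar) / real CARD('a))) t"
    using best_drift_ge[OF prob_vec_X] by (intro E_Suc_le[OF A]) (simp add: reward_drift_loss)
  then show ?thesis unfolding E_cmult[OF past_sets_subset[OF A]] by simp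
qed

lemma space_past_sets: "space M \<in> sets (past t)"
  using sets.top[of "past t"] by simp

lemma log_rate_min_nonneg:
  assumes "0 \<le> x" "x \<le> 1" shows "0 \<le> log_rate (min x (1 - x) / real CARD('a))"
proof (rule log_rate_nonneg)
  have N: "1 \<le> real CARD('a)" using two_arms by simp
  have "min x (1 - x) / real CARD('a) \<le> 1 / 1" using assms N by (intro frac_le) auto
  then show "min x (1 - x) / real CARD('a) \<le> 1" by simp
qed (use assms in simp)

text \<open>Each visit to \<open>{\<epsilon>..1 - \<epsilon>}\<close> lowers the expected loss
  \<open>1 - p\<close> at a rate of at least \<open>d\<close>. Telescoping bounds the sum of the
  visit probabilities, and Borel--Cantelli applies.\<close>

lemma AE_eventually_extreme:
  assumes \<epsilon>: "0 < \<epsilon>" "\<epsilon> \<le> 1"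
  shows "AE \<omega> in M. eventually (\<lambda>t. min (X t \<omega> astar) (1 - X t \<omega> astar) < \<epsilon>) sequentially"
proof -
  define D where "D = (\<lambda>q :: 'a \<Rightarrow> real. log_rate (min (q astar) (1 - q astar) / real CARD('a)))"
  define B where "B = (\<lambda>t. {\<omega>\<in>space M. \<not> min (X t \<omega> astar) (1 - X t \<omega> astar) < \<epsilon>})"
  define d where "d = gap * \<beta> * log_rate (\<epsilon> / real CARD('a))"
  have N: "1 \<le> real CARD('a)" using two_arms by simp
  have "\<epsilon> / real CARD('a) \<le> \<epsilon> / 1" using \<epsilon> N by (intro divide_left_mono) auto
  then have "\<epsilon> / real CARD('a) \<le> 1" using \<epsilon> by linarith
  then have "0 < log_rate (\<epsilon> / real CARD('a))"
    by (rule log_rate_pos[rotated]) (use \<epsilon> N in simp)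
  then have d: "0 < d" using gap_pos rate_pos by (simp add: d_def)
  have D0: "0 \<le> D (X t \<omega>)" for t \<omega>
    unfolding D_def using X_pos[of t \<omega> astar] X_le_1[of t \<omega> astar] by (intro log_rate_min_nonneg) auto
  have Bm: "B t \<in> events" for t
    unfolding B_def using past_sets_subset[OF X_event_past[of t t "\<lambda>q. \<not> min (q astar) (1 - q astar) < \<epsilon>", OF order_refl]] .
  have PB: "d * prob (B t) \<le> gap * \<beta> * E (space M) D t" for t
  proof -
    have "log_rate (\<epsilon> / real CARD('a)) * prob (B t) = E (B t) (\<lambda>_. log_rate (\<epsilon> / real CARD('a))) t"
      using Bm by (simp add: E_const)
    also have "\<dots> \<le> E (B t) D t"
    proof (rule E_mono[OF Bm])
      fix \<omega> assume "\<omega> \<in> B t"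
      then have "\<epsilon> \<le> min (X t \<omega> astar) (1 - X t \<omega> astar)"
        by (simp add: B_def not_less)
      moreover have "min (X t \<omega> astar) (1 - X t \<omega> astar) / real CARD('a) \<le> 1 / 1"
        using N X_le_1[of t \<omega> astar] by (intro frac_le) auto
      ultimately show "log_rate (\<epsilon> / real CARD('a)) \<le> D (X t \<omega>)"
        unfolding D_def using \<epsilon> N by (intro log_rate_mono divide_right_mono) auto
    qed
    also have "\<dots> \<le> E (space M) D t"
      unfolding E_def using Bm D0
      by (intro integral_mono E_integrable) (auto simp: indicator_def B_def)
    finally show ?thesis unfolding d_def
      using gap_pos rate_pos by (simp add: mult.assoc)
  qed
  have tel: "E (space M) (\<lambda>q. 1 - q astar) n + d * (\<Sum>t<n. prob (B t)) \<le> E (space M) (\<lambda>q. 1 - q astar) 0" for n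
  proof (induction n)
    case (Suc n)
    have "E (space M) (\<lambda>q. 1 - q astar) (Suc n) \<le> E (space M) (\<lambda>q. 1 - q astar) n
       - gap * \<beta> * E (space M) D n"
      unfolding D_def by (rule E_loss_Suc_le[OF space_past_sets])
    then show ?case using Suc PB[of n] by (simp add: algebra_simps)
  qed simp
  have "(\<Sum>t<n. prob (B t)) \<le> E (space M) (\<lambda>q. 1 - q astar) 0 / d" for n
  proof -
    have "0 \<le> E (space M) (\<lambda>q. 1 - q astar) n" using X_le_1 by (intro E_nonneg) simp
    then show ?thesis using tel[of n] d by (simp add: field_simps)
  qed
  then have "summable (\<lambda>t. prob (B t))" by (intro summableI_nonneg_bounded) auto
  then have "AE \<omega> in M. eventually (\<lambda>t. \<omega> \<in> space M - B t) sequentially"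
    using Bm by (intro borel_cantelli_AE1) (auto simp: emeasure_eq_measure)
  then show ?thesis
    by (rule AE_mp) (auto intro!: AE_I2 elim!: eventually_mono simp: B_def)
qed

text \<open>As long as \<open>p\<close> has stayed below \<open>\<epsilon>\<close> since time
  \<open>n\<close>, the process \<open>1 / p\<close> is a supermartingale. By Fatou its limit
  inferior on these events is almost surely finite, whereas
  \<open>p \<longlonglongrightarrow> 0\<close> would make it infinite.\<close>

lemma AE_not_eventually_small:
  assumes \<epsilon>: "\<epsilon> \<le> 1 / real CARD('a)"
    and small: "\<And>p. 0 < p \<Longrightarrow> p \<le> \<epsilon> \<Longrightarrow> alpha_log \<beta> p \<le> gap / 2"
  shows "AE \<omega> in M. \<not> ((\<forall>t\<ge>n. X t \<omega> astar < \<epsilon>) \<and> (\<lambda>t. X t \<omega> astar) \<longlonglongrightarrow> 0)"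
proof -
  define A where "A = (\<lambda>t. {\<omega>\<in>space M. \<forall>i\<in>{n..t}. X i \<omega> astar < \<epsilon>})"
  define f where "f = (\<lambda>q :: 'a \<Rightarrow> real. 1 / q astar)"
  have A: "A t \<in> sets (past t)" for t
  proof -
    have "A t = (\<Inter>i\<in>{n..t}. {\<omega>\<in>space M. X i \<omega> astar < \<epsilon>}) \<inter> space M" by (auto simp: A_def)
    also have "\<dots> \<in> sets (past t)"
    proof (cases "{n..t} = {}")
      case False
      then show ?thesis
        using X_event_past[of _ t "\<lambda>q. q astar < \<epsilon>"] space_past_sets by (intro sets.Int sets.finite_INT) auto
    qed (simp add: space_past_sets)
    finally show ?thesis .
  qed
  have Ae: "A t \<in> events" for t using past_sets_subset[OF A] .
  have f0: "0 \<le> f (X t \<omega>)" for t \<omega> using X_pos[of t \<omega> astar] by (simp add: f_def)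
  have step: "E (A (Suc t)) f (Suc t) \<le> E (A t) f t" if "n \<le> t" for t
  proof -
    \<comment> \<open>Enlarging the event costs nothing as \<open>f\<close> is nonnegative, and
      \<open>A t\<close> belongs to the past at time \<open>t\<close>, as the drift bound
      requires.\<close>
    have "E (A (Suc t)) f (Suc t) \<le> E (A t) f (Suc t)"
      unfolding E_def using Ae f0
      by (intro integral_mono E_integrable) (auto simp: indicator_def A_def)
    also have "\<dots> \<le> E (A t) f t + E (A t) (\<lambda>_. 0) t"
    proof (rule E_Suc_le[OF A])
      fix \<omega> s assume \<omega>: "\<omega> \<in> A t" and s: "s \<in> maxset (X t \<omega>)"
      then have x: "X t \<omega> astar < \<epsilon>" using that by (auto simp: A_def)
      then have "s \<noteq> astar" using \<epsilon> by (intro not_leader_if_small[OF prob_vec_X _ s]) simp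
      then show "reward_drift f (X t \<omega>) s \<le> 0"
        unfolding f_def using x X_pos[of t \<omega> astar]
        by (intro inverse_best_drift_le[OF prob_vec_X _ s] small) auto
    qed
    finally show ?thesis using Ae by (simp add: E_const)
  qed
  have bound: "E (A t) f t \<le> E (A n) f n" if "n \<le> t" for t
    using that by (induction t rule: dec_induct) (auto intro: order_trans step)
  define g where "g = (\<lambda>t \<omega>. ennreal (indicator (A t) \<omega> * f (X t \<omega>)))"
  have gm: "g t \<in> borel_measurable M" for t
    unfolding g_def using borel_measurable_integrable[OF E_integrable[OF Ae]] by simp
  have gE: "(\<integral>\<^sup>+\<omega>. g t \<omega> \<partial>M) = ennreal (E (A t) f t)" for t
    unfolding g_def E_def using f0
    by (intro nn_integral_eq_integral E_integrable Ae) (auto simp: indicator_def)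
  have "(\<integral>\<^sup>+\<omega>. liminf (\<lambda>t. g t \<omega>) \<partial>M) \<le> liminf (\<lambda>t. \<integral>\<^sup>+\<omega>. g t \<omega> \<partial>M)"
    by (rule nn_integral_liminf[OF gm])
  also have "\<dots> \<le> ennreal (E (A n) f n)"
  proof -
    have "eventually (\<lambda>t. (\<integral>\<^sup>+\<omega>. g t \<omega> \<partial>M) \<le> ennreal (E (A n) f n)) sequentially"
      unfolding gE eventually_sequentially using bound by (auto intro!: exI[of _ n] ennreal_leI)
    then have "liminf (\<lambda>t. \<integral>\<^sup>+\<omega>. g t \<omega> \<partial>M) \<le> liminf (\<lambda>t :: nat. ennreal (E (A n) f n))"
      by (rule Liminf_mono)
    then show ?thesis by (simp add: Liminf_const)
  qed
  finally have "(\<integral>\<^sup>+\<omega>. liminf (\<lambda>t. g t \<omega>) \<partial>M) \<noteq> \<infinity>"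
    by (auto simp: top_unique)
  then have "AE \<omega> in M. liminf (\<lambda>t. g t \<omega>) \<noteq> \<infinity>"
    using gm by (intro nn_integral_noteq_infinite) auto
  then show ?thesis
  proof (rule AE_mp, intro AE_I2 impI notI)
    fix \<omega> assume \<omega>: "\<omega> \<in> space M" and fin: "liminf (\<lambda>t. g t \<omega>) \<noteq> \<infinity>"
      and low: "(\<forall>t\<ge>n. X t \<omega> astar < \<epsilon>) \<and> (\<lambda>t. X t \<omega> astar) \<longlonglongrightarrow> 0"
    have "\<omega> \<in> A t" for t using low \<omega> by (auto simp: A_def)
    then have g: "g t \<omega> = ennreal (inverse (X t \<omega> astar))" for t
      by (simp add: g_def f_def inverse_eq_divide)
    have "filterlim (\<lambda>t. inverse (X t \<omega> astar)) at_top sequentially"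
      using low X_pos by (intro filterlim_inverse_at_top) auto
    then have "(\<lambda>t. g t \<omega>) \<longlonglongrightarrow> \<infinity>"
      unfolding g by (simp add: ennreal_tendsto_top_eq_at_top)
    then have "liminf (\<lambda>t. g t \<omega>) = \<infinity>" by (intro lim_imp_Liminf) auto
    then show False using fin by simp
  qed
qed

theorem AE_best_arm_tendsto_1: "AE \<omega> in M. (\<lambda>t. X t \<omega> astar) \<longlonglongrightarrow> 1"
proof -
  obtain \<delta> where \<delta>: "0 < \<delta>" "\<And>p. 0 < p \<Longrightarrow> p \<le> \<delta> \<Longrightarrow> alpha_log \<beta> p \<le> gap / 2"
    using alpha_log_small by blast
  \<comment> \<open>Below \<open>\<delta>\<close> the inverse has nonpositive drift, below
    \<open>1 / CARD('a)\<close> the optimal arm cannot lead, and below \<open>1 / 4\<close> doubling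
    stays below \<open>1 / 2\<close>.\<close>
  define \<epsilon> where "\<epsilon> = Min {\<delta>, 1 / real CARD('a), 1 / 4}"
  have \<epsilon>: "0 < \<epsilon>" "\<epsilon> \<le> \<delta>" "\<epsilon> \<le> 1 / real CARD('a)" "\<epsilon> \<le> 1 / 4"
    using \<delta>(1) two_arms by (auto simp: \<epsilon>_def)
  have 1: "AE \<omega> in M. \<forall>m. eventually (\<lambda>t. min (X t \<omega> astar) (1 - X t \<omega> astar) < 1 / real (Suc m)) sequentially"
    unfolding AE_all_countable by (intro allI AE_eventually_extreme) auto
  have 2: "AE \<omega> in M. eventually (\<lambda>t. min (X t \<omega> astar) (1 - X t \<omega> astar) < \<epsilon>) sequentially"
    using \<epsilon> by (intro AE_eventually_extreme) auto
  have 3: "AE \<omega> in M. \<forall>n. \<not> ((\<forall>t\<ge>n. X t \<omega> astar < \<epsilon>) \<and> (\<lambda>t. X t \<omega> astar) \<longlonglongrightarrow> 0)"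
    unfolding AE_all_countable using \<epsilon> \<delta>(2) by (intro allI AE_not_eventually_small) auto
  from 1 2 3 show ?thesis
  proof eventually_elim
    case (elim \<omega>)
    define x where "x = (\<lambda>t. X t \<omega> astar)"
    have x: "0 < x t" "x t \<le> 1" for t using X_pos X_le_1 by (auto simp: x_def)
    have lim: "(\<lambda>t. min (x t) (1 - x t)) \<longlonglongrightarrow> 0"
    proof (rule LIMSEQ_I)
      fix e :: real assume "0 < e"
      then obtain m where m: "1 / real (Suc m) < e" using nat_approx_posE by blast
      obtain n where "\<forall>t\<ge>n. min (x t) (1 - x t) < 1 / real (Suc m)"
        using elim(1) by (auto simp: eventually_sequentially x_def)
      moreover have "0 \<le> min (x t) (1 - x t)" for t using x[of t] by simp
      ultimately show "\<exists>no. \<forall>t\<ge>no. norm (min (x t) (1 - x t) - 0) < e"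
        using m by (intro exI[of _ n]) (auto intro: less_trans)
    qed
    obtain n where n: "\<And>t. t \<ge> n \<Longrightarrow> min (x t) (1 - x t) < \<epsilon>"
      using elim(2) by (auto simp: eventually_sequentially x_def)
    have stay: "x (Suc t) < \<epsilon>" if "t \<ge> n" "x t < \<epsilon>" for t
    proof -
      have "x (Suc t) \<le> 2 * x t"
      proof (rule X_Suc_cases[OF prob_vec_X, of t \<omega>])
        assume "X (Suc t) \<omega> = X t \<omega>"
        then show ?thesis using x[of t] by (simp add: x_def)
      next
        fix s a assume s: "s \<in> maxset (X t \<omega>)"
          and eq: "X (Suc t) \<omega> = samba_update (alpha_log \<beta>) (X t \<omega>) s a"
        have "s \<noteq> astar"
          using that(2) \<epsilon> by (intro not_leader_if_small[OF prob_vec_X _ s]) (simp add: x_def)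
        then show ?thesis unfolding x_def eq by (rule samba_update_le_double[OF prob_vec_X])
      qed
      \<comment> \<open>Below \<open>1 / 2\<close> the minimum of \<open>x\<close> and
        \<open>1 - x\<close> is \<open>x\<close>, so being extreme means being small: the gap
        between the two extremes is not crossed.\<close>
      then have "x (Suc t) < 1 / 2" using that \<epsilon>(4) by linarith
      then show ?thesis using n[of "Suc t"] that(1) \<epsilon>(4) by (auto simp: min_def split: if_splits)
    qed
    \<comment> \<open>After time \<open>n\<close>, a single value below \<open>\<epsilon>\<close>
      would keep the path there and drive it to 0, which has been excluded.\<close>
    have high: "\<not> x t < \<epsilon>" if "t \<ge> n" for t
    proof
      assume lt: "x t < \<epsilon>"
      have low: "x i < \<epsilon>" if "i \<ge> t" for i
        using that by (induction i rule: dec_induct) (use lt stay \<open>t \<ge> n\<close> in auto)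
      have "eventually (\<lambda>i. min (x i) (1 - x i) = x i) sequentially"
        unfolding eventually_sequentially
      proof (intro exI[of _ t] allI impI)
        fix i assume "t \<le> i"
        then have "x i < \<epsilon>" by (rule low)
        then show "min (x i) (1 - x i) = x i" using \<epsilon>(4) by simp
      qed
      then have "x \<longlonglongrightarrow> 0" using lim by (rule Lim_transform_eventually[rotated])
      then show False using elim(3) low by (auto simp: x_def)
    qed
    have "eventually (\<lambda>i. 1 - min (x i) (1 - x i) = x i) sequentially"
      unfolding eventually_sequentially
    proof (intro exI[of _ n] allI impI)
      fix i assume "n \<le> i"
      then have "1 - x i < \<epsilon>" using n[of i] high[of i] by (auto simp: min_def split: if_splits)
      then show "1 - min (x i) (1 - x i) = x i" using \<epsilon>(4) by simp
    qed
    moreover have "(\<lambda>t. 1 - min (x t) (1 - x t)) \<longlonglongrightarrow> 1 - 0" by (intro tendsto_diff tendsto_const lim)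
    ultimately have "x \<longlonglongrightarrow> 1 - 0" by (rule Lim_transform_eventually[rotated])
    then show ?case by (simp add: x_def)
  qed
qed

end

section \<open>Regret\<close>

context samba
begin

section \<open>The clock of times at which the optimal arm exceeds one half\<close>

primrec lead_count :: "nat \<Rightarrow> 'w \<Rightarrow> nat" where
  "lead_count 0 \<omega> = 0"
| "lead_count (Suc t) \<omega> = lead_count t \<omega> + (if 1 / 2 < X t \<omega> astar then 1 else 0)"

text \<open>On \<open>clock t k \<inter> leads t\<close>, the time \<open>t\<close> is the leading
  time with index \<open>k\<close>, counted from 0.\<close>

definition clock :: "nat \<Rightarrow> nat \<Rightarrow> 'w set" where
  "clock t k = {\<omega>\<in>space M. lead_count t \<omega> = k}"

text \<open>The threshold \<open>1 / 2\<close> forces the optimal arm to be the leader, and the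
  complement of this event is the one summed in \<open>Q\<close>.\<close>

definition leads :: "nat \<Rightarrow> 'w set" where
  "leads t = {\<omega>\<in>space M. 1 / 2 < X t \<omega> astar}"

lemma measurable_lead_count: "t \<le> t' \<Longrightarrow> lead_count t \<in> past t' \<rightarrow>\<^sub>M count_space UNIV"
proof (induction t)
  case 0
  have "lead_count 0 = (\<lambda>_. 0)" by auto
  then show ?case by simp
next
  case (Suc t)
  have "(\<lambda>\<omega>. k + (if 1 / 2 < X t \<omega> astar then 1 else 0)) \<in> past t' \<rightarrow>\<^sub>M count_space UNIV" for k :: nat
    by (rule measurable_compose[OF measurable_X_past[of t]]) (use Suc.prems in simp_all)
  moreover have "lead_count t \<in> past t' \<rightarrow>\<^sub>M count_space UNIV" using Suc by simp
  ultimately have "(\<lambda>\<omega>. lead_count t \<omega> + (if 1 / 2 < X t \<omega> astar then 1 else 0))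
      \<in> past t' \<rightarrow>\<^sub>M count_space UNIV"
    by (rule measurable_compose_countable)
  then show ?case by simp
qed

lemma clock_past: "clock t k \<in> sets (past t)"
  using measurable_sets[OF measurable_lead_count[OF order_refl], of "{k}" t]
  by (simp add: clock_def vimage_def Int_def conj_commute)

lemma leads_past: "leads t \<in> sets (past t)"
  unfolding leads_def by (rule X_event_past[OF order_refl])

lemma lead_count_le: "lead_count t \<omega> \<le> t"
  by (induction t) auto

lemma lead_count_mono: "i \<le> j \<Longrightarrow> lead_count i \<omega> \<le> lead_count j \<omega>"
  by (induction j rule: dec_induct) auto

text \<open>The count strictly increases after a leading time, so there is at most one leading time
  of index \<open>k\<close>.\<close>

lemma disjoint_lead_times: "disjoint_family (\<lambda>t. clock t k \<inter> leads t)"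
proof -
  have "lead_count i \<omega> < lead_count j \<omega>" if "i < j" "1 / 2 < X i \<omega> astar" for i j \<omega>
    using lead_count_mono[of "Suc i" j \<omega>] that by simp
  then show ?thesis
    unfolding disjoint_family_on_def clock_def leads_def
    by (auto simp: neq_iff) (metis less_irrefl)+
qed

lemma E_loss_mono:
  assumes "A \<in> sets (past t)"
  shows "E A (\<lambda>q. 1 - q astar) (Suc t) \<le> E A (\<lambda>q. 1 - q astar) t"
proof -
  have "0 \<le> E A (\<lambda>q. log_rate (min (q astar) (1 - q astar) / real CARD('a))) t"
    using X_pos X_le_1 by (intro E_nonneg log_rate_min_nonneg) (auto simp: less_imp_le)
  then have "0 \<le> gap * \<beta> * E A (\<lambda>q. log_rate (min (q astar) (1 - q astar) / real CARD('a))) t"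
    using gap_pos rate_pos by simp
  then show ?thesis using E_loss_Suc_le[OF assms] by linarith
qed

lemma E_loss_leads:
  assumes A: "A \<in> sets (past t)" and sub: "A \<subseteq> leads t"
  shows "E A (\<lambda>q. 1 - q astar) (Suc t)
    \<le> E A (\<lambda>q. 1 - q astar) t - gap * \<beta> * E A others_rate t"
proof -
  have "E A (\<lambda>q. 1 - q astar) (Suc t)
    \<le> E A (\<lambda>q. 1 - q astar) t + E A (\<lambda>q. - (gap * \<beta>) * others_rate q) t"
  proof (rule E_Suc_le[OF A])
    fix \<omega> s assume "\<omega> \<in> A" and s: "s \<in> maxset (X t \<omega>)"
    then have "1 / 2 < X t \<omega> astar" using sub by (auto simp: leads_def)
    then have "s = astar" using leader_if_gt_half[OF prob_vec_X _ s] by simp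
    then show "reward_drift (\<lambda>q. 1 - q astar) (X t \<omega>) s \<le> - (gap * \<beta>) * others_rate (X t \<omega>)"
      using best_drift_leader[OF prob_vec_X, of t \<omega>] by (simp add: reward_drift_loss)
  qed
  then show ?thesis unfolding E_cmult[OF past_sets_subset[OF A]] by simp
qed

text \<open>Expected loss at the leading time of index \<open>k\<close>, with contribution 0 if that
  time does not occur before \<open>T\<close>.\<close>

definition lead_loss :: "nat \<Rightarrow> nat \<Rightarrow> real" where
  "lead_loss T k = (\<Sum>t<T. E (clock t k \<inter> leads t) (\<lambda>q. 1 - q astar) t)"

definition lead_rate :: "nat \<Rightarrow> nat \<Rightarrow> real" where
  "lead_rate T k = (\<Sum>t<T. E (clock t k \<inter> leads t) others_rate t)"

lemma others_rate_nonneg: "prob_vec q \<Longrightarrow> 0 \<le> others_rate q"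
  unfolding others_rate_def
  using prob_vec_pos prob_vec_le_1 by (intro sum_nonneg log_rate_nonneg) (auto simp: less_imp_le)

text \<open>Between two consecutive times at which the optimal arm leads, its loss is a
  supermartingale; summing the balance over \<open>t\<close> replaces optional stopping.\<close>

lemma lead_loss_Suc_le: "lead_loss T (Suc k) \<le> lead_loss T k - gap * \<beta> * lead_rate T k"
proof -
  let ?f = "\<lambda>q :: 'a \<Rightarrow> real. 1 - q astar"
  have ev: "clock t k \<in> events" "leads t \<in> events" for t k
    using past_sets_subset clock_past leads_past by auto
  have past: "clock t k \<inter> leads t \<in> sets (past t)" "clock t k - leads t \<in> sets (past t)" for t k
    using clock_past leads_past by auto
  have step: "E (clock (Suc t) (Suc k)) ?f (Suc t)
      \<le> E (clock t (Suc k)) ?f t - E (clock t (Suc k) \<inter> leads t) ?f t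
        + E (clock t k \<inter> leads t) ?f t - gap * \<beta> * E (clock t k \<inter> leads t) others_rate t" for t
  proof -
    \<comment> \<open>The count is \<open>Suc k\<close> after time \<open>t\<close> either because
      it was so already and \<open>t\<close> is not a leading time, or because \<open>t\<close> is
      the leading time of index \<open>k\<close>.\<close>
    have "clock (Suc t) (Suc k) = (clock t (Suc k) - leads t) \<union> (clock t k \<inter> leads t)"
      by (auto simp: clock_def leads_def)
    then have "E (clock (Suc t) (Suc k)) ?f (Suc t)
        = E (clock t (Suc k) - leads t) ?f (Suc t) + E (clock t k \<inter> leads t) ?f (Suc t)"
      using ev by (auto intro!: E_Un)
    also have "E (clock t (Suc k) - leads t) ?f (Suc t) \<le> E (clock t (Suc k) - leads t) ?f t"
      by (rule E_loss_mono[OF past(2)])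
    also have "E (clock t k \<inter> leads t) ?f (Suc t)
        \<le> E (clock t k \<inter> leads t) ?f t - gap * \<beta> * E (clock t k \<inter> leads t) others_rate t"
      by (rule E_loss_leads[OF past(1)]) auto
    also have "E (clock t (Suc k) - leads t) ?f t
        = E (clock t (Suc k)) ?f t - E (clock t (Suc k) \<inter> leads t) ?f t"
    proof -
      have "E ((clock t (Suc k) - leads t) \<union> (clock t (Suc k) \<inter> leads t)) ?f t
          = E (clock t (Suc k) - leads t) ?f t + E (clock t (Suc k) \<inter> leads t) ?f t"
        using ev by (intro E_Un) auto
      moreover have "(clock t (Suc k) - leads t) \<union> (clock t (Suc k) \<inter> leads t) = clock t (Suc k)" by auto
      ultimately show ?thesis by simp
    qed
    finally show ?thesis by simp
  qed
  \<comment> \<open>The first summand carries the loss on paths still waiting, at the horizon, for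
    the leading time of index \<open>Suc k\<close>. It closes the induction and is then dropped as
    nonnegative.\<close>
  have "E (clock T (Suc k)) ?f T + lead_loss T (Suc k) \<le> lead_loss T k - gap * \<beta> * lead_rate T k"
  proof (induction T)
    case 0
    have "clock 0 (Suc k) = {}" by (simp add: clock_def)
    then show ?case by (simp add: lead_loss_def lead_rate_def E_def)
  next
    case (Suc T)
    then show ?case using step[of T] by (simp add: lead_loss_def lead_rate_def algebra_simps)
  qed
  moreover have "0 \<le> E (clock T (Suc k)) ?f T" using X_le_1 by (intro E_nonneg) simp
  ultimately show ?thesis by simp
qed

lemma lead_loss_nonneg: "0 \<le> lead_loss T k"
  unfolding lead_loss_def using X_le_1 by (intro sum_nonneg E_nonneg) simp

lemma lead_rate_nonneg: "0 \<le> lead_rate T k"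
  unfolding lead_rate_def by (intro sum_nonneg E_nonneg others_rate_nonneg prob_vec_X)

lemma sum_prob_lead_times_le: "(\<Sum>t<T. prob (clock t k \<inter> leads t)) \<le> 1"
proof -
  have "(\<Sum>t<T. prob (clock t k \<inter> leads t)) = prob (\<Union>t<T. clock t k \<inter> leads t)"
  proof (rule finite_measure_finite_Union[symmetric])
    show "(\<lambda>t. clock t k \<inter> leads t) ` {..<T} \<subseteq> events"
      using past_sets_subset[OF clock_past] past_sets_subset[OF leads_past] by auto
    show "disjoint_family_on (\<lambda>t. clock t k \<inter> leads t) {..<T}"
      using disjoint_lead_times by (rule disjoint_family_on_mono[rotated]) simp
  qed simp
  then show ?thesis by simp
qed

lemma lead_loss_le_1: "lead_loss T k \<le> 1"
proof -
  have ev: "clock t k \<inter> leads t \<in> events" for t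
    using past_sets_subset[OF clock_past] past_sets_subset[OF leads_past] by auto
  have "E (clock t k \<inter> leads t) (\<lambda>q. 1 - q astar) t \<le> prob (clock t k \<inter> leads t)" for t
  proof -
    have "E (clock t k \<inter> leads t) (\<lambda>q. 1 - q astar) t \<le> E (clock t k \<inter> leads t) (\<lambda>_. 1) t"
      using X_pos by (intro E_mono ev) (simp add: less_imp_le)
    then show ?thesis by (simp add: E_const ev)
  qed
  then have "lead_loss T k \<le> (\<Sum>t<T. prob (clock t k \<inter> leads t))"
    unfolding lead_loss_def by (intro sum_mono)
  then show ?thesis using sum_prob_lead_times_le by (rule order_trans)
qed

text \<open>Jensen's inequality through the tangent at the mean; the missing mass of the event that the
  \<open>k\<close>-th leading time occurs before \<open>T\<close> only helps, as \<open>log_rate 0 = 0\<close>.\<close>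

lemma lead_rate_ge:
  assumes pos: "0 < lead_loss T k"
  defines "n \<equiv> real (CARD('a) - 1)"
  shows "n * log_rate (lead_loss T k / n) \<le> lead_rate T k"
proof -
  have n: "1 \<le> n" using two_arms by (simp add: n_def)
  define s where "s = lead_loss T k / n"
  have s: "0 < s" "s \<le> 1" using pos n lead_loss_le_1[of T k] by (auto simp: s_def)
  \<comment> \<open>The tangent at \<open>s\<close> evaluated at 0, once for each of the
    \<open>n\<close> other arms.\<close>
  define c where "c = n * (log_rate s - s * log_rate' s)"
  have c: "c \<le> 0" unfolding c_def
    using log_rate_le_mult_deriv[OF s] n by (intro mult_nonneg_nonpos) auto
  have ev: "clock t k \<inter> leads t \<in> events" for t
    using past_sets_subset[OF clock_past] past_sets_subset[OF leads_past] by auto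
  \<comment> \<open>Tangents at the common point \<open>s\<close> are summed over the other arms,
    whose entries add up to \<open>1 - q astar\<close>.\<close>
  have pt: "c + log_rate' s * (1 - q astar) \<le> others_rate q" if q: "prob_vec q" for q
  proof -
    have "(\<Sum>a\<in>UNIV - {astar}. log_rate s + log_rate' s * (q a - s)) \<le> others_rate q"
      unfolding others_rate_def
      using prob_vec_pos[OF q] prob_vec_le_1[OF q] s by (intro sum_mono log_rate_above_tangent) auto
    moreover have "(\<Sum>a\<in>UNIV - {astar}. log_rate s + log_rate' s * (q a - s))
        = c + log_rate' s * (\<Sum>a\<in>UNIV - {astar}. q a)"
      by (simp add: c_def n_def sum.distrib sum_distrib_left[symmetric] sum_subtractf
          algebra_simps)
    ultimately show ?thesis using prob_vec_sum_compl[OF q] by simp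
  qed
  have "c * prob (clock t k \<inter> leads t) + log_rate' s * E (clock t k \<inter> leads t) (\<lambda>q. 1 - q astar) t
      \<le> E (clock t k \<inter> leads t) others_rate t" for t
  proof -
    have "E (clock t k \<inter> leads t) (\<lambda>q. c + log_rate' s * (1 - q astar)) t
        \<le> E (clock t k \<inter> leads t) others_rate t"
      by (intro E_mono ev pt prob_vec_X)
    then show ?thesis using E_add[OF ev] E_cmult[OF ev] E_const[OF ev] by simp
  qed
  then have "(\<Sum>t<T. c * prob (clock t k \<inter> leads t)
      + log_rate' s * E (clock t k \<inter> leads t) (\<lambda>q. 1 - q astar) t) \<le> lead_rate T k"
    unfolding lead_rate_def by (intro sum_mono)
  then have "c * (\<Sum>t<T. prob (clock t k \<inter> leads t)) + log_rate' s * lead_loss T k \<le> lead_rate T k"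
    by (simp add: sum.distrib sum_distrib_left lead_loss_def)
  \<comment> \<open>The probabilities sum to at most 1 and \<open>c \<le> 0\<close>, so replacing
    their sum by 1 only weakens the bound.\<close>
  moreover have "c * 1 \<le> c * (\<Sum>t<T. prob (clock t k \<inter> leads t))"
    using sum_prob_lead_times_le c by (rule mult_left_mono_neg)
  moreover have "lead_loss T k = n * s" using n by (simp add: s_def)
  ultimately show ?thesis unfolding s_def[symmetric] c_def by (simp add: algebra_simps)
qed

lemma sum_lead_loss_le:
  "(\<Sum>k<T. lead_loss T k) \<le> real (CARD('a) - 1) / (2 * (\<beta> * gap)) * (ln (\<beta> * gap * real T))\<^sup>2
    + of_int \<lceil>exp 1 / (\<beta> * gap)\<rceil>"
proof (rule sum_log_rate_recursion_le)
  show "0 < \<beta> * gap" using rate_pos gap_pos by simp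
  show "\<beta> * gap \<le> 1" using rate_pos rate_le_1 gap_pos gap_le_1 by (simp add: mult_le_one)
  show "1 \<le> CARD('a) - 1" using two_arms by simp
  have gb: "0 \<le> gap * \<beta>" using rate_pos gap_pos by simp
  fix k
  show "lead_loss T (Suc k) \<le> lead_loss T k
      - \<beta> * gap * real (CARD('a) - 1) * log_rate (lead_loss T k / real (CARD('a) - 1))"
    if "0 < lead_loss T k"
    using lead_loss_Suc_le[of T k] mult_left_mono[OF lead_rate_ge[OF that] gb]
    by (simp add: mult_ac)
  show "lead_loss T (Suc k) = 0" if "lead_loss T k = 0"
    using lead_loss_Suc_le[of T k] mult_nonneg_nonneg[OF gb lead_rate_nonneg[of T k]] that
      lead_loss_nonneg[of T "Suc k"] by linarith
qed (rule lead_loss_nonneg lead_loss_le_1)+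

text \<open>The count at time \<open>t\<close> is at most \<open>t\<close>, hence one of the indices
  below \<open>T\<close>.\<close>

lemma E_loss_leads_eq:
  assumes "t < T"
  shows "E (leads t) (\<lambda>q. 1 - q astar) t = (\<Sum>k<T. E (clock t k \<inter> leads t) (\<lambda>q. 1 - q astar) t)"
proof -
  have ev: "clock t k \<inter> leads t \<in> events" for k
    using past_sets_subset[OF clock_past] past_sets_subset[OF leads_past] by auto
  have sp: "indicator (leads t) \<omega> * x = (\<Sum>k<T. indicator (clock t k \<inter> leads t) \<omega> * x)" for \<omega> and x :: real
  proof -
    have "(\<Sum>k<T. indicator (clock t k \<inter> leads t) \<omega> * x)
        = (\<Sum>k<T. if k = lead_count t \<omega> then indicator (leads t) \<omega> * x else 0)"
      by (intro sum.cong) (auto simp: clock_def leads_def indicator_def)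
    also have "\<dots> = indicator (leads t) \<omega> * x" using lead_count_le[of t \<omega>] assms by simp
    finally show ?thesis by (rule sym)
  qed
  have "E (leads t) (\<lambda>q. 1 - q astar) t
      = (\<integral>\<omega>. (\<Sum>k<T. indicator (clock t k \<inter> leads t) \<omega> * (1 - X t \<omega> astar)) \<partial>M)"
    unfolding E_def by (intro Bochner_Integration.integral_cong refl sp)
  also have "\<dots> = (\<Sum>k<T. E (clock t k \<inter> leads t) (\<lambda>q. 1 - q astar) t)"
    unfolding E_def by (intro Bochner_Integration.integral_sum E_integrable ev)
  finally show ?thesis .
qed

section \<open>Decomposition and bound of the regret\<close>

text \<open>Integrating out the current noise replaces the played reward at time \<open>t\<close> by
  its conditional mean given the state.\<close>

lemma regret_eq:
  "regret M (alpha_log \<beta>) p0 \<xi> (r astar) T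
    = (\<Sum>t<T. E (space M) (\<lambda>q. r astar - (\<Sum>a\<in>UNIV. q a * r a)) t)"
proof -
  have eq: "indicator (space M) \<omega> * (x::real) = x" if "\<omega> \<in> space M" for \<omega> x using that by simp
  have int: "integrable M (\<lambda>\<omega>. played_reward (X t \<omega>) (\<xi> t \<omega>))"
    and ev: "(\<integral>\<omega>. played_reward (X t \<omega>) (\<xi> t \<omega>) \<partial>M) = E (space M) (\<lambda>q. \<Sum>a\<in>UNIV. q a * r a) t" for t
  proof -
    have i: "integrable M (\<lambda>\<omega>. indicator (space M) \<omega> * played_reward (X t \<omega>) (\<xi> t \<omega>))"
      by (rule integral_past_step(1)[OF space_past_sets integral_played_reward(1)])
    then show "integrable M (\<lambda>\<omega>. played_reward (X t \<omega>) (\<xi> t \<omega>))"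
      by (subst (asm) Bochner_Integration.integrable_cong[OF refl eq])
    have "(\<integral>\<omega>. played_reward (X t \<omega>) (\<xi> t \<omega>) \<partial>M)
        = (\<integral>\<omega>. indicator (space M) \<omega> * played_reward (X t \<omega>) (\<xi> t \<omega>) \<partial>M)"
      by (intro Bochner_Integration.integral_cong refl eq[symmetric])
    also have "\<dots> = E (space M) (\<lambda>q. \<integral>w. played_reward q w \<partial>noise_measure r) t"
      by (rule integral_past_step(2)[OF space_past_sets integral_played_reward(1)])
    also have "\<dots> = E (space M) (\<lambda>q. \<Sum>a\<in>UNIV. q a * r a) t"
      unfolding E_def by (simp add: integral_played_reward(2)[OF prob_vec_X])
    finally show "(\<integral>\<omega>. played_reward (X t \<omega>) (\<xi> t \<omega>) \<partial>M) = E (space M) (\<lambda>q. \<Sum>a\<in>UNIV. q a * r a) t" .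
  qed
  have "E (space M) (\<lambda>q. r astar - (\<Sum>a\<in>UNIV. q a * r a)) t
      = r astar - E (space M) (\<lambda>q. \<Sum>a\<in>UNIV. q a * r a) t" for t
    using E_add[OF sets.top, of "\<lambda>_. r astar" "\<lambda>q. (- 1) * (\<Sum>a\<in>UNIV. q a * r a)" t]
      E_cmult[OF sets.top, of "- 1" "\<lambda>q. \<Sum>a\<in>UNIV. q a * r a" t]
      E_const[OF sets.top, of "r astar" t] by (simp add: prob_space)
  then show ?thesis
    unfolding regret_def using int ev
    by (simp add: Bochner_Integration.integral_sum sum_subtractf)
qed

text \<open>As rewards lie between 0 and 1, a step costs at most the probability
  \<open>1 - p\<close> of playing another arm. This is kept at leading times and bounded by 1
  elsewhere.\<close>

lemma instant_regret_le:
  "E (space M) (\<lambda>q. r astar - (\<Sum>a\<in>UNIV. q a * r a)) t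
    \<le> E (leads t) (\<lambda>q. 1 - q astar) t + prob {\<omega>\<in>space M. X t \<omega> astar \<le> 1 / 2}"
proof -
  let ?B = "{\<omega>\<in>space M. X t \<omega> astar \<le> 1 / 2}"
  have L: "leads t \<in> events" using past_sets_subset[OF leads_past] .
  have B: "?B \<in> events" using past_sets_subset[OF X_event_past[of t t "\<lambda>q. q astar \<le> 1 / 2", OF order_refl]] .
  have pt: "r astar - (\<Sum>a\<in>UNIV. q a * r a) \<le> 1 - q astar" if q: "prob_vec q" for q
  proof -
    have "(\<Sum>a\<in>UNIV. q a * r a) = q astar * r astar + (\<Sum>a\<in>UNIV - {astar}. q a * r a)"
      by (rule sum.remove) auto
    moreover have "0 \<le> (\<Sum>a\<in>UNIV - {astar}. q a * r a)"
      using prob_vec_pos[OF q] reward_bounds by (intro sum_nonneg mult_nonneg_nonneg) (auto simp: less_imp_le)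
    moreover have "r astar * (1 - q astar) \<le> 1 * (1 - q astar)"
      using reward_bounds prob_vec_le_1[OF q, of astar] by (intro mult_right_mono) auto
    ultimately show ?thesis by (simp add: algebra_simps)
  qed
  have "E (space M) (\<lambda>q. r astar - (\<Sum>a\<in>UNIV. q a * r a)) t \<le> E (space M) (\<lambda>q. 1 - q astar) t"
    by (intro E_mono pt prob_vec_X) auto
  also have "E (space M) (\<lambda>q. 1 - q astar) t
      = E (leads t) (\<lambda>q. 1 - q astar) t + E ?B (\<lambda>q. 1 - q astar) t"
  proof -
    have "space M = leads t \<union> ?B" by (auto simp: leads_def)
    moreover have "E (leads t \<union> ?B) (\<lambda>q. 1 - q astar) t
        = E (leads t) (\<lambda>q. 1 - q astar) t + E ?B (\<lambda>q. 1 - q astar) t"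
      by (intro E_Un L B) (auto simp: leads_def)
    ultimately show ?thesis by metis
  qed
  also have "E ?B (\<lambda>q. 1 - q astar) t \<le> E ?B (\<lambda>_. 1) t"
    using X_pos by (intro E_mono B) (simp add: less_imp_le)
  also have "\<dots> = prob ?B" using B by (simp add: E_const)
  finally show ?thesis by simp
qed

text \<open>Summability makes the series the actual value of \<open>Q\<close>; for a divergent
  series \<open>Q\<close> is infinite and the bound says nothing.\<close>

theorem regret_le:
  assumes Q: "summable (\<lambda>t. prob {\<omega>\<in>space M. X t \<omega> astar \<le> 1 / 2})"
  shows "regret M (alpha_log \<beta>) p0 \<xi> (r astar) T
    \<le> real CARD('a) / (2 * \<beta> * gap) * (ln (\<beta> * gap * real T))\<^sup>2
      + (\<Sum>t. prob {\<omega>\<in>space M. X t \<omega> astar \<le> 1 / 2}) + of_int \<lceil>exp 1 / (\<beta> * gap)\<rceil>"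
proof -
  have "regret M (alpha_log \<beta>) p0 \<xi> (r astar) T
      \<le> (\<Sum>t<T. E (leads t) (\<lambda>q. 1 - q astar) t + prob {\<omega>\<in>space M. X t \<omega> astar \<le> 1 / 2})"
    unfolding regret_eq by (intro sum_mono instant_regret_le)
  also have "\<dots> = (\<Sum>t<T. E (leads t) (\<lambda>q. 1 - q astar) t)
      + (\<Sum>t<T. prob {\<omega>\<in>space M. X t \<omega> astar \<le> 1 / 2})"
    by (rule sum.distrib)
  also have "(\<Sum>t<T. prob {\<omega>\<in>space M. X t \<omega> astar \<le> 1 / 2})
      \<le> (\<Sum>t. prob {\<omega>\<in>space M. X t \<omega> astar \<le> 1 / 2})"
    using Q by (intro sum_le_suminf) auto
  also have "(\<Sum>t<T. E (leads t) (\<lambda>q. 1 - q astar) t)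
      = (\<Sum>t<T. \<Sum>k<T. E (clock t k \<inter> leads t) (\<lambda>q. 1 - q astar) t)"
    by (intro sum.cong E_loss_leads_eq) auto
  \<comment> \<open>Exchanging the sums passes from real time to the index of the leading time, in
    which the recursion holds.\<close>
  also have "\<dots> = (\<Sum>k<T. lead_loss T k)"
    unfolding lead_loss_def by (rule sum.swap)
  also have "\<dots> \<le> real (CARD('a) - 1) / (2 * (\<beta> * gap)) * (ln (\<beta> * gap * real T))\<^sup>2
      + of_int \<lceil>exp 1 / (\<beta> * gap)\<rceil>"
    by (rule sum_lead_loss_le)
  also have "real (CARD('a) - 1) / (2 * (\<beta> * gap)) * (ln (\<beta> * gap * real T))\<^sup>2
      \<le> real CARD('a) / (2 * \<beta> * gap) * (ln (\<beta> * gap * real T))\<^sup>2"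
    using rate_pos gap_pos by (intro mult_right_mono) (auto simp: mult.assoc divide_right_mono)
  finally show ?thesis by simp
qed

end

section \<open>Markov property, convergence and regret bound for the given noise\<close>

theorem theorem2:
  fixes M :: "'w measure" and \<xi> :: "nat \<Rightarrow> 'w \<Rightarrow> ('a::{finite,linorder}) noise"
    and r p0 :: "'a \<Rightarrow> real" and astar :: 'a and \<beta> :: real
  assumes "prob_space M"
    and "prob_space.indep_vars M (\<lambda>_. noise_measure r) \<xi> UNIV"
    and "\<forall>t. distr M (noise_measure r) (\<xi> t) = noise_measure r"
    and "\<forall>a. 0 \<le> r a \<and> r a \<le> 1"
    and "CARD('a) \<ge> 2"
    and "\<forall>a. a \<noteq> astar \<longrightarrow> r a < r astar"
    and "\<forall>a. 0 < p0 a" and "(\<Sum>a\<in>UNIV. p0 a) = 1"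
    and "0 < \<beta>" and "\<beta> \<le> 1"
  defines "X \<equiv> samba_X (alpha_log \<beta>) p0 \<xi>"
    and "\<Delta> \<equiv> r astar - Max (r ` (UNIV - {astar}))"
  shows "(\<forall>t. X t \<in> measurable M (count_space UNIV))
       \<and> (\<forall>t (xs :: nat \<Rightarrow> 'a \<Rightarrow> real) y.
            measure M {\<omega>\<in>space M. (\<forall>i\<le>t. X i \<omega> = xs i) \<and> X (Suc t) \<omega> = y}
              * measure M {\<omega>\<in>space M. X t \<omega> = xs t}
          = measure M {\<omega>\<in>space M. \<forall>i\<le>t. X i \<omega> = xs i}
              * measure M {\<omega>\<in>space M. X t \<omega> = xs t \<and> X (Suc t) \<omega> = y})
       \<and> (AE \<omega> in M. (\<lambda>t. X t \<omega> astar) \<longlonglongrightarrow> 1)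
       \<and> (\<forall>T::nat. summable (\<lambda>t. measure M {\<omega>\<in>space M. X t \<omega> astar \<le> 1/2}) \<longrightarrow>
            regret M (alpha_log \<beta>) p0 \<xi> (r astar) T
              \<le> real CARD('a) / (2 * \<beta> * \<Delta>) * (ln (\<beta> * \<Delta> * real T))^2
                 + (\<Sum>t. measure M {\<omega>\<in>space M. X t \<omega> astar \<le> 1/2})
                 + of_int \<lceil>exp 1 / (\<beta> * \<Delta>)\<rceil>)"
proof -
  interpret prob_space M by fact
  interpret S: samba r astar \<beta> M \<xi> p0
    using assms by unfold_locales (auto simp: prob_vec_def)
  have "S.gap = \<Delta>" by (simp add: S.gap_def \<Delta>_def)
  then show ?thesis
    using S.measurable_X S.markov_property S.AE_best_arm_tendsto_1 S.regret_le
    unfolding X_def by simp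
qed

end
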